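(* Let $H$ be a finite subgroup of $GL_n(\mathbb{C})$ with $n\ge1$. Assume $p\nmid m$, where $m=|H|$. Then there is a finite subgroup $G$ of $GL_n(V)$ with $G\cong H$ as groups. Furthermore, if $H\subseteq SL_n(\mathbb{C})$ then $G\subseteq SL_n(V)$.
   Context: $(V,\pi)$ is a complete discrete valuation ring of characteristic zero (uniformizer $\pi$) whose residue field $k=V/(\pi)$ is algebraically closed of characteristic $p>0$. *)

theory Defs
  imports
    "HOL-Algebra.Algebraic_Closure_Type"
    "Jordan_Normal_Form.Determinant"
begin

definition discrete_valuation_ring :: "('a, 'b) ring_scheme \<Rightarrow> bool" where
  "discrete_valuation_ring R \<longleftrightarrow>
     principal_domain R \<and> \<not> Ring.field R \<and> (\<exists>!M. maximalideal M R)"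

definition uniformizer :: "('a, 'b) ring_scheme \<Rightarrow> 'a \<Rightarrow> bool" where
  "uniformizer R \<pi> \<longleftrightarrow> \<pi> \<in> carrier R \<and> maximalideal (PIdl\<^bsub>R\<^esub> \<pi>) R"

text \<open>Completeness for the topology whose neighbourhoods of zero are the ideals generated by the
  powers of \<open>\<pi>\<close>: every Cauchy sequence converges. Limits are not required to be unique; in a
  discrete valuation ring with uniformizer \<open>\<pi>\<close> they are, as the intersection of these ideals is
  zero.\<close>

definition adically_complete :: "('a, 'b) ring_scheme \<Rightarrow> 'a \<Rightarrow> bool" where
  "adically_complete R \<pi> \<longleftrightarrow>
     (\<forall>u :: nat \<Rightarrow> 'a. range u \<subseteq> carrier R \<longrightarrow>
        (\<forall>k::nat. \<exists>N. \<forall>i\<ge>N. \<forall>j\<ge>N. u i \<ominus>\<^bsub>R\<^esub> u j \<in> PIdl\<^bsub>R\<^esub> (\<pi> [^]\<^bsub>R\<^esub> k)) \<longrightarrow>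
        (\<exists>l\<in>carrier R. \<forall>k::nat. \<exists>N. \<forall>i\<ge>N. u i \<ominus>\<^bsub>R\<^esub> l \<in> PIdl\<^bsub>R\<^esub> (\<pi> [^]\<^bsub>R\<^esub> k)))"

definition residue_field :: "('a, 'b) ring_scheme \<Rightarrow> 'a \<Rightarrow> 'a set ring" where
  "residue_field R \<pi> = R Quot (PIdl\<^bsub>R\<^esub> \<pi>)"

definition has_characteristic :: "('a, 'b) ring_scheme \<Rightarrow> nat \<Rightarrow> bool" where
  "has_characteristic R p \<longleftrightarrow> (\<forall>n::nat. [n] \<cdot>\<^bsub>R\<^esub> \<one>\<^bsub>R\<^esub> = \<zero>\<^bsub>R\<^esub> \<longleftrightarrow> p dvd n)"

definition GL :: "nat \<Rightarrow> 'a::comm_ring_1 mat monoid" where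
  "GL n = units_of (ring_mat TYPE('a) n ())"

definition SL :: "nat \<Rightarrow> 'a::comm_ring_1 mat set" where
  "SL n = {A \<in> carrier_mat n n. det A = 1}"

end

theory Submission
  imports Defs
begin

text \<open>
  The representation of \<open>H\<close> on complex column vectors is reduced modulo \<open>p\<close> and then lifted to \<open>V\<close>.

  \<^item> Reduction. Consider subrings of the complex numbers with a homomorphism to the residue field
    \<open>k\<close> of \<open>V\<close>, for example the integers. By Zorn's lemma there is a maximal one, a place. Since \<open>k\<close> is
    algebraically closed, its domain \<open>B\<close> is a valuation ring of the complex numbers
    (lemma \<open>valuation_ring\<close>, a theorem of Chevalley). The place carries all of the complex numbers that are
    integral for it to \<open>k\<close>, however large the two fields are compared to each other. Over a valuation
    ring a finite linear group can be conjugated so that all its entries lie in \<open>B\<close>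
    (\<open>conjugate_into_valuation_ring\<close>), and applying the place gives a representation over \<open>k\<close>.

  \<^item> Lifting. Since \<open>p\<close> does not divide the order \<open>m\<close> of \<open>H\<close>, the cohomological obstruction to lifting from
    \<open>\<pi>\<^sup>k\<close> to \<open>\<pi>\<^sup>k\<^sup>+\<^sup>1\<close> vanishes, by an explicit average over the group. Completeness gives a limit over \<open>V\<close>
    (\<open>lift_hom\<close>).

  \<^item> Nothing is lost. An element of \<open>H\<close> in the kernel of the lift has trivial reduction, and the kernel
    of reduction meets a group of order prime to \<open>p\<close> trivially (\<open>reduction_faithful\<close>). For the same
    reason a determinant over \<open>V\<close>, which is an \<open>m\<close>-th root of unity, equals \<open>1\<close> when it reduces
    to \<open>1\<close> (\<open>root_of_unity_eq_1\<close>), so special linear groups stay special linear.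

  All reductions are handled through representatives in \<open>V\<close> and congruences modulo \<open>\<pi>\<close>, since the residue
  field is not a type.
\<close>

section \<open>Discrete valuation rings and their residue fields\<close>

abbreviation univ_ring :: "'a::comm_ring_1 ring" where "univ_ring \<equiv> ring_of_type_algebra"

lemma univ_ring_simps:
  "carrier (univ_ring :: 'a::comm_ring_1 ring) = UNIV" "x \<otimes>\<^bsub>univ_ring\<^esub> y = x * y" "x \<oplus>\<^bsub>univ_ring\<^esub> y = x + y"
  "\<one>\<^bsub>univ_ring\<^esub> = (1::'a)" "\<zero>\<^bsub>univ_ring\<^esub> = (0::'a)"
  by (auto simp: ring_of_type_algebra_def)

lemma univ_ring_minus: "x \<ominus>\<^bsub>univ_ring\<^esub> y = x - (y :: 'a::comm_ring_1)"
proof -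
  interpret cring "univ_ring :: 'a ring" by (rule cring_from_type_algebra)
  have "\<ominus>\<^bsub>univ_ring\<^esub> y = - y"
    by (rule minus_equality) (auto simp: univ_ring_simps)
  then show ?thesis by (simp add: a_minus_def univ_ring_simps)
qed

lemma univ_ring_pow: "x [^]\<^bsub>univ_ring\<^esub> (k::nat) = (x :: 'a::comm_ring_1) ^ k"
proof -
  interpret cring "univ_ring :: 'a ring" by (rule cring_from_type_algebra)
  show ?thesis by (induction k) (auto simp: univ_ring_simps mult.commute)
qed

lemma univ_ring_PIdl: "PIdl\<^bsub>univ_ring\<^esub> x = {y :: 'a::comm_ring_1. x dvd y}"
  by (auto simp: cgenideal_def univ_ring_simps dvd_def mult.commute)

lemma univ_ring_ideal:
  assumes "0 \<in> I" "\<And>x y. x \<in> I \<Longrightarrow> y \<in> I \<Longrightarrow> x + y \<in> I" "\<And>x r. x \<in> I \<Longrightarrow> r * x \<in> I"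
  shows "ideal I (univ_ring :: 'a::comm_ring_1 ring)"
proof -
  interpret cring "univ_ring :: 'a ring" by (rule cring_from_type_algebra)
  have neg: "\<ominus>\<^bsub>univ_ring\<^esub> y = - y" for y :: 'a
    by (rule minus_equality) (auto simp: univ_ring_simps)
  show ?thesis
    apply (rule idealI)
    subgoal by (rule ring_axioms)
    subgoal
      by (rule add.subgroupI)
        (use assms(1,2) assms(3)[where r="-1"] in \<open>auto simp: univ_ring_simps neg a_inv_def[symmetric]\<close>)
    using assms(3) by (auto simp: univ_ring_simps mult.commute)
qed

lemma uniformizer_nonunit:
  assumes "uniformizer (univ_ring :: 'a::comm_ring_1 ring) \<pi>"
  shows "\<not> \<pi> dvd 1"
proof
  assume "\<pi> dvd 1"
  then have "PIdl\<^bsub>univ_ring\<^esub> \<pi> = carrier univ_ring"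
    by (auto simp: univ_ring_PIdl univ_ring_simps intro: dvd_trans[OF _ one_dvd])
  with assms show False
    using maximalideal.I_notcarr by (auto simp: uniformizer_def)
qed

text \<open>In a principal domain a nonunit \<open>v \<noteq> 0\<close> has an irreducible divisor, which generates a maximal
  ideal; as there is only one maximal ideal, \<open>\<pi>\<close> divides that divisor and hence \<open>v\<close>.\<close>

lemma dvr_unit:
  assumes "discrete_valuation_ring (univ_ring :: 'a::comm_ring_1 ring)" "uniformizer (univ_ring :: 'a ring) \<pi>"
    and v: "\<not> \<pi> dvd v"
  shows "v dvd 1"
proof (rule ccontr)
  assume nu: "\<not> v dvd 1"
  interpret principal_domain "univ_ring :: 'a ring"
    using assms(1) by (simp add: discrete_valuation_ring_def)
  have "v \<in> carrier univ_ring - {\<zero>\<^bsub>univ_ring\<^esub>}" "v \<notin> Units univ_ring"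
    using v nu by (auto simp: univ_ring_simps Units_def) (metis dvd_triv_left)
  then obtain q where q: "ring_irreducible\<^bsub>univ_ring\<^esub> q" "q divides\<^bsub>univ_ring\<^esub> v"
    by (rule exists_irreducible_divisor)
  then have "maximalideal (PIdl\<^bsub>univ_ring\<^esub> q) univ_ring"
    by (intro irreducible_imp_maximalideal) (auto simp: univ_ring_simps)
  then have "PIdl\<^bsub>univ_ring\<^esub> q = PIdl\<^bsub>univ_ring\<^esub> \<pi>"
    using assms by (auto simp: discrete_valuation_ring_def uniformizer_def)
  then have "\<pi> dvd q" unfolding univ_ring_PIdl by (metis dvd_refl mem_Collect_eq)
  moreover have "q dvd v" using q(2) by (auto simp: factor_def univ_ring_simps)
  ultimately show False using v dvd_trans by blast
qed

text \<open>If \<open>v = \<pi>\<^sup>k y\<^sub>k\<close> for all \<open>k\<close>, then \<open>y\<^sub>k = \<pi> y\<^sub>k\<^sub>+\<^sub>1\<close>, so the ideals generated by the \<open>y\<^sub>k\<close>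
  increase; their union is principal, the chain stops, and \<open>\<pi>\<close> would be a unit.\<close>

lemma dvr_power_dvd_all:
  assumes "discrete_valuation_ring (univ_ring :: 'a::idom ring)" "uniformizer (univ_ring :: 'a ring) \<pi>"
    and v: "\<And>k::nat. \<pi> ^ k dvd v"
  shows "v = (0::'a)"
proof (rule ccontr)
  assume nz: "v \<noteq> 0"
  interpret principal_domain "univ_ring :: 'a ring"
    using assms(1) by (simp add: discrete_valuation_ring_def)
  obtain y where y: "v = \<pi> ^ k * y k" for k :: nat
    using v unfolding dvd_def by metis
  have \<pi>0: "\<pi> \<noteq> 0" using nz y[of 1] by auto
  have step: "y k = \<pi> * y (Suc k)" for k
    using y[of k] y[of "Suc k"] \<pi>0 by simp
  have dvd: "y (k + j) dvd y k" for k j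
    by (induction j) (auto intro: dvd_trans simp: step[of "k + _"])
  let ?I = "\<Union>k. {z. y k dvd z}"
  have "ideal ?I univ_ring"
  proof (rule univ_ring_ideal)
    fix a b assume "a \<in> ?I" "b \<in> ?I"
    then obtain i j where "y i dvd a" "y j dvd b" by auto
    then have "y (i + j) dvd a" "y (i + j) dvd b"
      using dvd[of i j] dvd[of j i] by (auto intro: dvd_trans simp: add.commute)
    then show "a + b \<in> ?I" by (auto intro: dvd_add)
  qed (auto intro: dvd_mult)
  then obtain z where z: "?I = {x. z dvd x}"
    using exists_gen[of ?I] unfolding univ_ring_PIdl by metis
  then have "z \<in> ?I" using dvd_refl by blast
  then obtain k where "y k dvd z" by auto
  moreover have "z dvd y (Suc k)"
  proof -
    have "y (Suc k) \<in> ?I" using dvd_refl by blast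
    then show ?thesis unfolding z by simp
  qed
  ultimately have "\<pi> * y (Suc k) dvd y (Suc k)" using step[of k] by (auto intro: dvd_trans)
  moreover have "y (Suc k) \<noteq> 0" using nz y[of "Suc k"] by auto
  ultimately have "\<pi> dvd 1"
    by (metis dvd_mult_cancel_right mult_1)
  with uniformizer_nonunit[OF assms(2)] show False by simp
qed

text \<open>List polynomials carry the leading coefficient first, coefficient lists of type \<open>poly\<close> the
  constant term; hence the reversal.\<close>

lemma univ_ring_eval: "ring.eval (univ_ring :: 'a::comm_ring_1 ring) l x = poly (Poly (rev l)) x"
proof -
  interpret cring "univ_ring :: 'a ring" by (rule cring_from_type_algebra)
  show ?thesis
  proof (induction l)
    case (Cons a l)
    then show ?case by (simp add: univ_ring_simps univ_ring_pow Poly_append poly_monom)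
  qed (simp add: univ_ring_simps)
qed

lemma univ_ring_coset_eq_zero:
  fixes \<pi> :: "'a::comm_ring_1"
  defines "I \<equiv> PIdl\<^bsub>univ_ring\<^esub> \<pi>"
  shows "I +>\<^bsub>univ_ring\<^esub> a = \<zero>\<^bsub>univ_ring Quot I\<^esub> \<longleftrightarrow> \<pi> dvd a"
proof -
  interpret R: cring "univ_ring :: 'a ring" by (rule cring_from_type_algebra)
  interpret I: ideal I "univ_ring :: 'a ring" unfolding I_def
    by (rule R.cgenideal_ideal) (simp add: univ_ring_simps)
  have "I +>\<^bsub>univ_ring\<^esub> a = I \<longleftrightarrow> a \<in> I"
    using I.a_rcos_const[of a] I.a_rcos_self[of a] by (auto simp: univ_ring_simps)
  then show ?thesis by (simp add: FactRing_def I_def univ_ring_PIdl)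
qed

lemma residue_root:
  fixes F :: "'a::comm_ring_1 poly"
  assumes "algebraically_closed (residue_field univ_ring \<pi>)"
    and "0 < Polynomial.degree F" "\<not> \<pi> dvd Polynomial.lead_coeff F"
  shows "\<exists>v. \<pi> dvd poly F v"
proof -
  define I where "I = PIdl\<^bsub>(univ_ring::'a ring)\<^esub> \<pi>"
  interpret R: cring "univ_ring :: 'a ring" by (rule cring_from_type_algebra)
  interpret I: ideal I "univ_ring :: 'a ring" unfolding I_def
    by (rule R.cgenideal_ideal) (simp add: univ_ring_simps)
  interpret L: algebraically_closed "(univ_ring :: 'a ring) Quot I"
    using assms(1) by (simp add: residue_field_def I_def)
  interpret h: ring_hom_ring "univ_ring :: 'a ring" "(univ_ring :: 'a ring) Quot I" "(+>\<^bsub>(univ_ring::'a ring)\<^esub>) I"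
    by (rule I.rcos_ring_hom_ring)
  note zero = univ_ring_coset_eq_zero[of \<pi>, folded I_def]
  let ?l = "rev (coeffs F)"
  let ?p = "map ((+>\<^bsub>(univ_ring::'a ring)\<^esub>) I) ?l"
  have F0: "F \<noteq> 0" using assms(2) by auto
  have carr: "?p \<in> carrier (poly_ring (univ_ring Quot I))"
  proof -
    have "hd ?p = I +>\<^bsub>univ_ring\<^esub> Polynomial.lead_coeff F"
      using F0 by (simp add: hd_map hd_rev last_coeffs_eq_coeff_degree)
    moreover have "set ?p \<subseteq> carrier (univ_ring Quot I)"
      using h.hom_closed by (auto simp: univ_ring_simps)
    ultimately show ?thesis
      using assms(3) zero by (auto simp: univ_poly_def polynomial_def)
  qed
  then have "L.splitted ?p" by (rule L.roots_over_carrier)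
  moreover have "length ?p - 1 > 0" using assms(2) F0 by (simp add: length_coeffs)
  ultimately have "L.roots ?p \<noteq> {#}" by (auto simp: L.splitted_def)
  then obtain x where "x \<in># L.roots ?p" by blast
  then have x: "x \<in> carrier (univ_ring Quot I)" "L.eval ?p x = \<zero>\<^bsub>univ_ring Quot I\<^esub>"
    using L.roots_mem_iff_is_root[OF carr] by (auto simp: L.is_root_def)
  have "x \<in> a_rcosets\<^bsub>univ_ring\<^esub> I" using x(1) by (simp only: FactRing_def partial_object.simps)
  then obtain v where v: "x = I +>\<^bsub>univ_ring\<^esub> v"
    unfolding A_RCOSETS_def' by blast
  have "L.eval ?p x = I +>\<^bsub>univ_ring\<^esub> (R.eval ?l v)"
    unfolding v by (rule h.eval_hom'[symmetric]) (auto simp: univ_ring_simps)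
  also have "R.eval ?l v = poly F v" by (simp add: univ_ring_eval)
  finally show ?thesis using x zero by auto
qed

text \<open>The residue field is a quotient of the ring and no type of its own, so its properties are
  phrased with representatives: nonzero residues are represented by units, and a polynomial whose
  reduction has positive degree has a root modulo \<open>\<pi>\<close>.\<close>

locale alg_closed_residue =
  fixes \<pi> :: "'v :: idom"
  assumes nonunit: "\<not> \<pi> dvd 1"
    and unit: "\<And>v. \<not> \<pi> dvd v \<Longrightarrow> v dvd 1"
    and root: "\<And>F :: 'v poly. 0 < Polynomial.degree F \<Longrightarrow> \<not> \<pi> dvd Polynomial.lead_coeff F \<Longrightarrow>
      \<exists>v. \<pi> dvd poly F v"

lemma alg_closed_residue_dvr:
  assumes "discrete_valuation_ring (univ_ring :: 'a::idom ring)" "uniformizer (univ_ring :: 'a ring) \<pi>"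
    and "algebraically_closed (residue_field univ_ring \<pi>)"
  shows "alg_closed_residue \<pi>"
  using uniformizer_nonunit[OF assms(2)] dvr_unit[OF assms(1,2)] residue_root[OF assms(3)]
  by unfold_locales auto

lemma residue_characteristic:
  assumes "has_characteristic (residue_field (univ_ring :: 'a::comm_ring_1 ring) \<pi>) p"
  shows "\<pi> dvd (of_nat m :: 'a) \<longleftrightarrow> p dvd m"
proof -
  define I where "I = PIdl\<^bsub>(univ_ring::'a ring)\<^esub> \<pi>"
  interpret R: cring "univ_ring :: 'a ring" by (rule cring_from_type_algebra)
  interpret I: ideal I "univ_ring :: 'a ring" unfolding I_def
    by (rule R.cgenideal_ideal) (simp add: univ_ring_simps)
  interpret h: ring_hom_ring "univ_ring :: 'a ring" "(univ_ring :: 'a ring) Quot I" "(+>\<^bsub>(univ_ring::'a ring)\<^esub>) I"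
    by (rule I.rcos_ring_hom_ring)
  note zero = univ_ring_coset_eq_zero[of \<pi>, folded I_def]
  have "[m] \<cdot>\<^bsub>univ_ring Quot I\<^esub> \<one>\<^bsub>univ_ring Quot I\<^esub> = I +>\<^bsub>univ_ring\<^esub> (of_nat m)"
  proof (induction m)
    case (Suc m)
    then show ?case using h.hom_add[of "of_nat m" 1] h.hom_one
     by (auto simp: univ_ring_simps add.commute)
  qed (use zero in \<open>auto\<close>)
  then have "\<pi> dvd (of_nat m :: 'a) \<longleftrightarrow> [m] \<cdot>\<^bsub>univ_ring Quot I\<^esub> \<one>\<^bsub>univ_ring Quot I\<^esub> = \<zero>\<^bsub>univ_ring Quot I\<^esub>"
    by (simp only: zero)
  also have "\<dots> \<longleftrightarrow> p dvd m"
    using assms unfolding has_characteristic_def residue_field_def I_def[symmetric] by blast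
  finally show ?thesis .
qed

section \<open>Places with values in an algebraically closed residue field\<close>

lemma poly_sum_coeff_le:
  fixes f :: "'a::comm_semiring_1 poly"
  assumes "Polynomial.degree f \<le> d"
  shows "poly f x = (\<Sum>i\<le>d. Polynomial.coeff f i * x ^ i)"
  by (subst poly_as_sum_of_monoms'[OF assms, symmetric]) (simp add: poly_sum poly_monom)

text \<open>A subring of a field with a homomorphism to the residue field of \<open>\<pi>\<close> is encoded by the set \<open>M\<close>
  of all pairs of an element and a representative of its image. Such an \<open>M\<close> is a subring of the
  product of the two rings, and the condition on its fibre over \<open>0\<close> says that the image is
  well defined and that all its representatives are present.\<close>

locale partial_place = alg_closed_residue \<pi> for \<pi> :: "'v::idom" +
  fixes M :: "('k::field \<times> 'v) set"
  assumes one: "(1, 1) \<in> M"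
    and diff: "(a, x) \<in> M \<Longrightarrow> (b, y) \<in> M \<Longrightarrow> (a - b, x - y) \<in> M"
    and mult: "(a, x) \<in> M \<Longrightarrow> (b, y) \<in> M \<Longrightarrow> (a * b, x * y) \<in> M"
    and fibre: "(0, y) \<in> M \<longleftrightarrow> \<pi> dvd y"
begin

lemma zero: "(0, 0) \<in> M"
  using fibre by simp

lemma add: "(a, x) \<in> M \<Longrightarrow> (b, y) \<in> M \<Longrightarrow> (a + b, x + y) \<in> M"
  using diff[of a x "0 - b" "0 - y"] diff[OF zero, of b y] by simp

lemma power: "(a, x) \<in> M \<Longrightarrow> (a ^ n, x ^ n) \<in> M"
  by (induction n) (auto intro: one mult)

lemma sum: "(\<And>i. i \<in> A \<Longrightarrow> (f i, F i) \<in> M) \<Longrightarrow> ((\<Sum>i\<in>A. f i), (\<Sum>i\<in>A. F i)) \<in> M"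
  by (induction A rule: infinite_finite_induct) (auto intro: zero add)

lemma prod: "(\<And>i. i \<in> A \<Longrightarrow> (f i, F i) \<in> M) \<Longrightarrow> ((\<Prod>i\<in>A. f i), (\<Prod>i\<in>A. F i)) \<in> M"
  by (induction A rule: infinite_finite_induct) (auto intro: one mult)

lemma residue_unique: "(a, x) \<in> M \<Longrightarrow> (a, y) \<in> M \<Longrightarrow> \<pi> dvd x - y"
  using diff fibre by fastforce

lemma residue_change: "(a, x) \<in> M \<Longrightarrow> \<pi> dvd x - y \<Longrightarrow> (a, y) \<in> M"
  using diff[of a x 0 "x - y"] fibre by simp

lemma ideal_mult: "(a, x) \<in> M \<Longrightarrow> (b, 0) \<in> M \<Longrightarrow> (a * b, 0) \<in> M"
  using mult[of a x b 0] by simp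

lemma residue_nonzero: "(a, x) \<in> M \<Longrightarrow> \<not> \<pi> dvd x \<Longrightarrow> a \<noteq> 0"
  using fibre by auto

text \<open>Pairs of a polynomial over the domain of the place and a representative of its reduction. The
  two degrees are unrelated, as leading coefficients may reduce to zero.\<close>

definition polys :: "('k poly \<times> 'v poly) set" where
  "polys = {(f, F). \<forall>i. (Polynomial.coeff f i, Polynomial.coeff F i) \<in> M}"

lemma polysD: "(f, F) \<in> polys \<Longrightarrow> (Polynomial.coeff f i, Polynomial.coeff F i) \<in> M"
  by (simp add: polys_def)

lemma polys_diff: "(f, F) \<in> polys \<Longrightarrow> (g, G) \<in> polys \<Longrightarrow> (f - g, F - G) \<in> polys"
  by (auto simp: polys_def intro: diff)

lemma polys_mult: "(f, F) \<in> polys \<Longrightarrow> (g, G) \<in> polys \<Longrightarrow> (f * g, F * G) \<in> polys"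
  by (auto simp: polys_def coeff_mult intro!: sum mult)

lemma polys_monom: "(a, x) \<in> M \<Longrightarrow> (Polynomial.monom a n, Polynomial.monom x n) \<in> polys"
  by (auto simp: polys_def intro: zero)

lemma polys_const: "(a, x) \<in> M \<Longrightarrow> ([:a:], [:x:]) \<in> polys"
  using polys_monom[of a x 0] by (simp add: monom_0)

text \<open>A place extends to the subring generated by \<open>x\<close>, with \<open>x\<close> going to the class of \<open>w\<close>, as soon as every
  algebraic relation of \<open>x\<close> is respected by \<open>w\<close>.\<close>

lemma extension:
  assumes "\<And>f F. (f, F) \<in> polys \<Longrightarrow> poly f x = 0 \<Longrightarrow> \<pi> dvd poly F w"
  defines "N \<equiv> {(poly f x, poly F w) | f F. (f, F) \<in> polys}"
  shows "partial_place \<pi> N" "M \<subseteq> N" "(x, w) \<in> N"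
proof -
  have memI: "(poly f x, poly F w) \<in> N" if "(f, F) \<in> polys" for f F
    using that unfolding N_def by blast
  show sub: "M \<subseteq> N"
  proof
    fix z assume "z \<in> M"
    then show "z \<in> N" using memI[OF polys_const[of "fst z" "snd z"]] by simp
  qed
  show "(x, w) \<in> N"
    using memI[OF polys_monom[OF one, of 1]] by (simp add: poly_monom)
  show "partial_place \<pi> N"
  proof
    show "(1, 1) \<in> N" using sub one by auto
    show "(a - b, y - z) \<in> N" if ab: "(a, y) \<in> N" "(b, z) \<in> N" for a b y z
    proof -
      obtain f F where "(f, F) \<in> polys" "a = poly f x" "y = poly F w"
        using ab(1) unfolding N_def by blast
      moreover obtain g G where "(g, G) \<in> polys" "b = poly g x" "z = poly G w"
        using ab(2) unfolding N_def by blast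
      ultimately show ?thesis using memI[OF polys_diff[of f F g G]] by simp
    qed
    show "(a * b, y * z) \<in> N" if ab: "(a, y) \<in> N" "(b, z) \<in> N" for a b y z
    proof -
      obtain f F where "(f, F) \<in> polys" "a = poly f x" "y = poly F w"
        using ab(1) unfolding N_def by blast
      moreover obtain g G where "(g, G) \<in> polys" "b = poly g x" "z = poly G w"
        using ab(2) unfolding N_def by blast
      ultimately show ?thesis using memI[OF polys_mult[of f F g G]] by simp
    qed
    show "(0, y) \<in> N \<longleftrightarrow> \<pi> dvd y" for y
    proof
      assume "(0, y) \<in> N"
      then obtain f F where "(f, F) \<in> polys" "(0, y) = (poly f x, poly F w)"
        unfolding N_def by blast
      then show "\<pi> dvd y" using assms(1) by simp
    next
      assume "\<pi> dvd y"
      then show "(0, y) \<in> N" using sub fibre by auto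
    qed
  qed
qed

end

locale maximal_place = partial_place \<pi> M for \<pi> :: "'v::idom" and M :: "('k::field \<times> 'v) set" +
  assumes maximal: "partial_place \<pi> N \<Longrightarrow> M \<subseteq> N \<Longrightarrow> N = M"
begin

lemma mem_if_compatible:
  assumes "\<And>f F. (f, F) \<in> polys \<Longrightarrow> poly f x = 0 \<Longrightarrow> \<pi> dvd poly F w"
  shows "(x, w) \<in> M"
proof -
  let ?N = "{(poly f x, poly F w) | f F. (f, F) \<in> polys}"
  have "partial_place \<pi> ?N" "M \<subseteq> ?N" "(x, w) \<in> ?N"
    using extension[of x w] assms by blast+
  then show ?thesis using maximal by blast
qed

text \<open>The domain of a maximal place is local. A relation for \<open>inverse a\<close> becomes, after multiplication
  by a power of \<open>a\<close>, an identity between elements of the domain; it can be reduced, and the power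
  of \<open>y\<close> that arises is cancelled with \<open>w\<close>.\<close>

lemma inverse:
  assumes "(a, y) \<in> M" "y * w = 1"
  shows "(inverse a, w) \<in> M"
proof (rule mem_if_compatible)
  fix f F assume fF: "(f, F) \<in> polys" and 0: "poly f (inverse a) = 0"
  have "\<not> \<pi> dvd y" using assms(2) nonunit by (metis dvd_mult2)
  then have "a \<noteq> 0" using residue_nonzero assms by auto
  define d where "d = max (Polynomial.degree f) (Polynomial.degree F)"
  have "a ^ d * poly f (inverse a) = (\<Sum>i\<le>d. Polynomial.coeff f i * a ^ (d - i))"
    using \<open>a \<noteq> 0\<close> unfolding d_def
    by (subst poly_sum_coeff_le[of _ d]) (auto simp: d_def sum_distrib_left power_diff power_inverse field_simps intro!: sum.cong)
  moreover have "y ^ d * poly F w = (\<Sum>i\<le>d. Polynomial.coeff F i * y ^ (d - i))"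
  proof -
    have "y ^ d * w ^ i = y ^ (d - i)" if "i \<le> d" for i
    proof -
      have "y ^ d = y ^ (d - i) * y ^ i" using that by (simp flip: power_add)
      then show ?thesis using assms(2) by (simp add: mult.assoc flip: power_mult_distrib)
    qed
    then show ?thesis unfolding d_def
      by (subst poly_sum_coeff_le[of _ d]) (auto simp: d_def sum_distrib_left mult.left_commute intro!: sum.cong)
  qed
  moreover have "((\<Sum>i\<le>d. Polynomial.coeff f i * a ^ (d - i)), (\<Sum>i\<le>d. Polynomial.coeff F i * y ^ (d - i))) \<in> M"
    using fF assms(1) by (intro sum mult power polysD)
  ultimately have "(0, y ^ d * poly F w) \<in> M" using 0 by simp
  then have "\<pi> dvd w ^ d * (y ^ d * poly F w)" using fibre by auto
  also have "w ^ d * (y ^ d * poly F w) = (y * w) ^ d * poly F w"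
    by (simp add: power_mult_distrib mult_ac)
  finally show "\<pi> dvd poly F w" using assms(2) by simp
qed

text \<open>Long division modulo \<open>\<pi>\<close>: to see that \<open>w\<close> respects all relations of \<open>x\<close> it is enough to cancel the
  leading term of each one by a relation that \<open>w\<close> respects. Leading coefficients divisible by \<open>\<pi>\<close>
  represent zero and are dropped.\<close>

lemma compatible_by_descent:
  assumes step: "\<And>f F. (f, F) \<in> polys \<Longrightarrow> poly f x = 0 \<Longrightarrow> \<not> \<pi> dvd Polynomial.lead_coeff F \<Longrightarrow>
      \<exists>g G. (g, G) \<in> polys \<and> poly g x = 0 \<and> \<pi> dvd poly G w \<and>
        Polynomial.degree G \<le> Polynomial.degree F \<and>
        Polynomial.coeff G (Polynomial.degree F) = Polynomial.lead_coeff F"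
    and "(f, F) \<in> polys" "poly f x = 0"
  shows "\<pi> dvd poly F w"
proof -
  have "\<pi> dvd poly F w" if "(f, F) \<in> polys" "poly f x = 0" "\<forall>i\<ge>n. Polynomial.coeff F i = 0" for n f F
    using that
  proof (induction n arbitrary: f F)
    case 0
    then have "F = 0" by (auto simp: poly_eq_iff)
    then show ?case by simp
  next
    case (Suc n)
    let ?c = "Polynomial.coeff F n"
    show ?case
    proof (cases "\<pi> dvd ?c")
      case True
      define F' where "F' = F - Polynomial.monom ?c n"
      have "(f, F') \<in> polys"
        using polys_diff[OF Suc.prems(1) polys_monom[of 0 ?c n]] True fibre by (simp add: F'_def)
      moreover have "\<forall>i\<ge>n. Polynomial.coeff F' i = 0"
      proof (intro allI impI)
        fix i assume "n \<le> i"
        then show "Polynomial.coeff F' i = 0"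
          using Suc.prems(3) by (cases "i = n") (auto simp: F'_def)
      qed
      ultimately have "\<pi> dvd poly F' w" using Suc.IH Suc.prems(2) by blast
      moreover have "poly F w = poly F' w + ?c * w ^ n" by (simp add: F'_def poly_monom)
      ultimately show ?thesis using True by simp
    next
      case False
      then have "?c \<noteq> 0" by auto
      then have deg: "Polynomial.degree F = n"
        using Suc.prems(3) by (intro antisym degree_le le_degree) auto
      obtain g G where g: "(g, G) \<in> polys" "poly g x = 0" "\<pi> dvd poly G w"
        "Polynomial.degree G \<le> n" "Polynomial.coeff G n = ?c"
        using step[OF Suc.prems(1,2)] False deg by auto
      have "\<forall>i\<ge>n. Polynomial.coeff (F - G) i = 0"
      proof (intro allI impI)
        fix i assume "n \<le> i"
        then show "Polynomial.coeff (F - G) i = 0"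
          using g(4,5) Suc.prems(3) by (cases "i = n") (auto simp: coeff_eq_0)
      qed
      then have "\<pi> dvd poly (F - G) w"
        using Suc.IH[OF polys_diff[OF Suc.prems(1) g(1)]] Suc.prems(2) g(2) by simp
      then show ?thesis using g(3) dvd_add[of \<pi> "poly F w - poly G w" "poly G w"] by simp
    qed
  qed
  from this[OF assms(2,3), of "Suc (Polynomial.degree F)"] show ?thesis
    by (auto simp: coeff_eq_0)
qed

text \<open>Polynomials with coefficients in the maximal ideal of the domain.\<close>

definition small_polys :: "'k poly set" where
  "small_polys = {f. \<forall>i. (Polynomial.coeff f i, 0) \<in> M}"

text \<open>The reductions of the relations of \<open>x\<close> form an ideal in the polynomials over a field. If it is zero,
  \<open>x\<close> may be sent anywhere; if it has a nonconstant generator, \<open>x\<close> may be sent to a root of it, which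
  exists since the residue field is algebraically closed. By maximality \<open>x\<close> then already lies in the
  domain. Otherwise the ideal is everything, which is the second alternative: \<open>1\<close> lies in the
  extension of the maximal ideal to the subring generated by \<open>x\<close>.\<close>

lemma mem_or_small_relation:
  "(\<exists>w. (x, w) \<in> M) \<or> (\<exists>f\<in>small_polys. poly f x = 1)"
proof -
  define I where "I = {(f, F). (f, F) \<in> polys \<and> poly f x = 0 \<and> \<not> \<pi> dvd Polynomial.lead_coeff F}"
  show ?thesis
  proof (cases "I = {}")
    case True
    have "(x, 0) \<in> M"
    proof (rule mem_if_compatible)
      fix f F assume f: "(f, F) \<in> polys" "poly f x = 0"
      show "\<pi> dvd poly F 0"
        by (rule compatible_by_descent[OF _ f]) (use True in \<open>auto simp: I_def\<close>)
    qed
    then show ?thesis by blast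
  next
    case False
    \<comment> \<open>A relation whose reduction generates the ideal: one of least degree.\<close>
    then obtain z where z: "z \<in> I" "\<And>z'. z' \<in> I \<Longrightarrow> Polynomial.degree (snd z) \<le> Polynomial.degree (snd z')"
      using ex_has_least_nat[of "\<lambda>z. z \<in> I" _ "\<lambda>z. Polynomial.degree (snd z)"] by blast
    obtain f0 F0 where [simp]: "z = (f0, F0)" by (cases z)
    define d where "d = Polynomial.degree F0"
    define a where "a = Polynomial.coeff f0 d"
    have f0: "(f0, F0) \<in> polys" "poly f0 x = 0" and lc: "\<not> \<pi> dvd Polynomial.lead_coeff F0"
      using z(1) by (auto simp: I_def)
    obtain u where u: "Polynomial.lead_coeff F0 * u = 1"
      using unit[OF lc] by (metis dvdE)
    have au: "(inverse a, u) \<in> M"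
      using inverse[OF polysD[OF f0(1)] u] by (simp add: a_def d_def)
    show ?thesis
    proof (cases "d = 0")
      case True
      have "a \<noteq> 0"
        using residue_nonzero[OF polysD[OF f0(1), of d]] lc by (simp add: a_def d_def)
      define f where "f = 1 - Polynomial.smult (inverse a) f0"
      have "(Polynomial.coeff f i, 0) \<in> M" for i
      proof (cases "i = 0")
        case True
        then show ?thesis using \<open>a \<noteq> 0\<close> \<open>d = 0\<close> zero by (simp add: f_def a_def)
      next
        case False
        then have "(Polynomial.coeff f0 i, 0) \<in> M"
          using polysD[OF f0(1), of i] \<open>d = 0\<close> by (simp add: d_def coeff_eq_0)
        from diff[OF zero ideal_mult[OF au this]] False show ?thesis
          by (simp add: f_def coeff_1)
      qed
      moreover have "poly f x = 1" by (simp add: f_def f0(2))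
      ultimately show ?thesis unfolding small_polys_def by blast
    next
      case False
      then obtain w where w: "\<pi> dvd poly F0 w"
        using root[of F0] lc by (auto simp: d_def)
      have "(x, w) \<in> M"
      proof (rule mem_if_compatible, rule compatible_by_descent)
        fix f F assume f: "(f, F) \<in> polys" "poly f x = 0" "\<not> \<pi> dvd Polynomial.lead_coeff F"
        define n where "n = Polynomial.degree F"
        have "d \<le> n" using z(2)[of "(f, F)"] f by (simp add: I_def d_def n_def)
        define G where "G = Polynomial.monom (Polynomial.coeff F n * u) (n - d) * F0"
        define g where "g = Polynomial.monom (Polynomial.coeff f n * inverse a) (n - d) * f0"
        have "(g, G) \<in> polys" unfolding g_def G_def
          by (intro polys_mult polys_monom mult au polysD f(1) f0(1))
        moreover have "poly g x = 0" by (simp add: g_def f0(2))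
        moreover have "\<pi> dvd poly G w" using w by (simp add: G_def)
        moreover have "Polynomial.degree G \<le> n"
          using degree_mult_le[of "Polynomial.monom (Polynomial.coeff F n * u) (n - d)" F0]
            degree_monom_le[of "Polynomial.coeff F n * u" "n - d"] \<open>d \<le> n\<close>
          by (simp add: G_def d_def)
        moreover have "Polynomial.coeff G n = Polynomial.coeff F n"
          using \<open>d \<le> n\<close> u by (simp add: G_def coeff_monom_mult d_def mult.assoc mult.commute[of u])
        ultimately show "\<exists>g G. (g, G) \<in> polys \<and> poly g x = 0 \<and> \<pi> dvd poly G w \<and>
            Polynomial.degree G \<le> Polynomial.degree F \<and>
            Polynomial.coeff G (Polynomial.degree F) = Polynomial.lead_coeff F"
          unfolding n_def by blast
      qed
      then show ?thesis by blast
    qed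
  qed
qed

text \<open>Both relations cannot hold. The constant coefficient of \<open>1 - g\<close> is a unit, so the relation for
  \<open>inverse x\<close> expresses \<open>x\<^sup>s\<close> by lower powers of \<open>x\<close> with coefficients in the maximal ideal whenever
  \<open>degree g \<le> s\<close>; for \<open>s = degree f\<close> this lowers the degree of the relation for \<open>x\<close>. By symmetry the
  larger of the two degrees can always be lowered.\<close>

lemma small_relations_incompatible:
  assumes "f \<in> small_polys" "poly f x = 1" "g \<in> small_polys" "poly g (inverse x) = 1" "x \<noteq> 0"
  shows False
  using assms
proof (induction "Polynomial.degree f + Polynomial.degree g" arbitrary: f g x rule: less_induct)
  case less
  have reduce: "\<exists>f'\<in>small_polys. Polynomial.degree f' < Polynomial.degree f \<and> poly f' x = 1"
    if f: "f \<in> small_polys" "poly f x = 1" and g: "g \<in> small_polys" "poly g (inverse x) = 1"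
      and x: "x \<noteq> 0" and le: "Polynomial.degree g \<le> Polynomial.degree f" for f g x
  proof -
    define s where "s = Polynomial.degree f"
    define t where "t = Polynomial.degree g"
    have cf: "(Polynomial.coeff f i, 0) \<in> M" and cg: "(Polynomial.coeff g i, 0) \<in> M" for i
      using f(1) g(1) by (auto simp: small_polys_def)
    have s: "s \<noteq> 0"
    proof
      assume "s = 0"
      then obtain c where "f = [:c:]" unfolding s_def by (rule degree_eq_zeroE)
      then have "(1, 0) \<in> M" using cf[of 0] f(2) by simp
      then show False using diff[OF one, of 1 0] fibre nonunit by simp
    qed
    define e where "e = 1 - Polynomial.coeff g 0"
    have e: "(e, 1) \<in> M" using diff[OF one cg[of 0]] by (simp add: e_def)
    have "e \<noteq> 0" using residue_nonzero[OF e nonunit] .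
    have b: "(inverse e, 1) \<in> M" by (rule inverse[OF e]) simp
    \<comment> \<open>The low-degree expression for \<open>x\<^sup>s\<close>, obtained by multiplying the relation for \<open>inverse x\<close> by \<open>x\<^sup>s\<close>.\<close>
    define h where "h = (\<Sum>j=1..t. Polynomial.monom (inverse e * Polynomial.coeff g j) (s - j))"
    have ch: "(Polynomial.coeff h i, 0) \<in> M" for i
      using sum[of "{1..t}" "\<lambda>j. if s - j = i then inverse e * Polynomial.coeff g j else 0" "\<lambda>_. 0"]
        ideal_mult[OF b cg] zero by (simp add: h_def coeff_sum)
    have ph: "poly h x = x ^ s"
    proof -
      have "1 = (\<Sum>j\<le>t. Polynomial.coeff g j * inverse x ^ j)"
        using g(2) by (simp add: poly_altdef t_def)
      also have "\<dots> = Polynomial.coeff g 0 + (\<Sum>j=1..t. Polynomial.coeff g j * inverse x ^ j)"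
        by (simp add: atMost_atLeast0 sum.atLeast_Suc_atMost)
      finally have "e = (\<Sum>j=1..t. Polynomial.coeff g j * inverse x ^ j)"
        by (metis e_def add_diff_cancel_left')
      then have "x ^ s = inverse e * (x ^ s * (\<Sum>j=1..t. Polynomial.coeff g j * inverse x ^ j))"
        using \<open>e \<noteq> 0\<close> by simp
      also have "\<dots> = (\<Sum>j=1..t. inverse e * Polynomial.coeff g j * x ^ (s - j))"
        unfolding sum_distrib_left
      proof (rule sum.cong)
        fix j assume "j \<in> {1..t}"
        then have "j \<le> s" using le by (simp add: s_def t_def)
        then have "x ^ s * inverse x ^ j = x ^ (s - j)"
          using x by (simp add: power_diff power_inverse field_simps)
        then show "inverse e * (x ^ s * (Polynomial.coeff g j * inverse x ^ j)) =
            inverse e * Polynomial.coeff g j * x ^ (s - j)" by (simp add: mult_ac)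
      qed simp
      finally show ?thesis by (simp add: h_def poly_sum poly_monom)
    qed
    have dh: "Polynomial.coeff h i = 0" if "s \<le> i" for i
    proof -
      have "s - j \<noteq> i" if "j \<in> {1..t}" for j using s that \<open>s \<le> i\<close> by auto
      then show ?thesis by (simp add: h_def coeff_sum)
    qed
    define f' where "f' = f - Polynomial.monom (Polynomial.coeff f s) s + Polynomial.smult (Polynomial.coeff f s) h"
    have "Polynomial.coeff f' i = 0" if "s \<le> i" for i
      using dh that by (cases "i = s") (auto simp: f'_def coeff_eq_0 s_def)
    then have "Polynomial.degree f' < s"
      using s by (metis leI leading_coeff_0_iff degree_0 bot_nat_0.not_eq_extremum)
    \<comment> \<open>Position \<open>Suc s\<close> lies beyond the degree of \<open>f\<close> and stands for a zero coefficient.\<close>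
    moreover have "(Polynomial.coeff f' i, 0) \<in> M" for i
      using add[OF diff[OF cf[of i] cf[of "if i = s then s else Suc s"]] ideal_mult[OF cf[of s] ch[of i]]]
      by (cases "i = s") (auto simp: f'_def s_def coeff_eq_0)
    moreover have "poly f' x = 1" by (simp add: f'_def poly_monom ph f(2))
    ultimately show ?thesis unfolding small_polys_def s_def by blast
  qed
  show False
  proof (cases "Polynomial.degree g \<le> Polynomial.degree f")
    case True
    obtain f' where "f' \<in> small_polys" "Polynomial.degree f' < Polynomial.degree f" "poly f' x = 1"
      using reduce[OF less.prems True] by blast
    then show False using less.hyps[of f' g x] less.prems by simp
  next
    case False
    then have le: "Polynomial.degree f \<le> Polynomial.degree g" by simp
    have "poly f (inverse (inverse x)) = 1" "inverse x \<noteq> 0" using less.prems by auto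
    from reduce[OF less.prems(3,4,1) this le] obtain g'
      where "g' \<in> small_polys" "Polynomial.degree g' < Polynomial.degree g" "poly g' (inverse x) = 1"
      by blast
    then show False using less.hyps[of f g' x] less.prems by simp
  qed
qed

lemma valuation_ring:
  assumes "x \<noteq> 0"
  shows "(\<exists>w. (x, w) \<in> M) \<or> (\<exists>w. (inverse x, w) \<in> M)"
  using mem_or_small_relation[of x] mem_or_small_relation[of "inverse x"]
    small_relations_incompatible[of _ x] assms by blast

end

text \<open>Zorn's lemma, starting from the reduction of the integers.\<close>

lemma (in alg_closed_residue) exists_maximal_place:
  assumes char: "\<And>n::int. (of_int n :: 'k::field) = 0 \<Longrightarrow> \<pi> dvd of_int n"
  obtains M :: "('k::field \<times> 'v) set" where "maximal_place \<pi> M"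
proof -
  let ?A = "{M :: ('k \<times> 'v) set. partial_place \<pi> M}"
  let ?M0 = "{(of_int n :: 'k, of_int n + \<pi> * v) | n v. True}"
  have M0: "(of_int n :: 'k, of_int n + \<pi> * v) \<in> ?M0" for n v by blast
  have "partial_place \<pi> ?M0"
  proof
    show "(1, 1) \<in> ?M0" using M0[of 1 0] by simp
    show "(a - b, y - z) \<in> ?M0" if ab: "(a, y) \<in> ?M0" "(b, z) \<in> ?M0" for a b y z
    proof -
      obtain n v where "a = of_int n" "y = of_int n + \<pi> * v"
        using ab(1) by blast
      moreover obtain n' v' where "b = of_int n'" "z = of_int n' + \<pi> * v'"
        using ab(2) by blast
      ultimately show ?thesis using M0[of "n - n'" "v - v'"] by (simp add: algebra_simps)
    qed
    show "(a * b, y * z) \<in> ?M0" if ab: "(a, y) \<in> ?M0" "(b, z) \<in> ?M0" for a b y z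
    proof -
      obtain n v where "a = of_int n" "y = of_int n + \<pi> * v"
        using ab(1) by blast
      moreover obtain n' v' where "b = of_int n'" "z = of_int n' + \<pi> * v'"
        using ab(2) by blast
      ultimately show ?thesis
        using M0[of "n * n'" "of_int n * v' + v * of_int n' + \<pi> * v * v'"]
        by (simp add: algebra_simps)
    qed
    show "(0, y) \<in> ?M0 \<longleftrightarrow> \<pi> dvd y" for y
    proof
      assume "(0, y) \<in> ?M0"
      then obtain n v where "(0, y) = (of_int n :: 'k, of_int n + \<pi> * v)" by blast
      then show "\<pi> dvd y" using char[of n] by auto
    next
      assume "\<pi> dvd y"
      then obtain v where "y = \<pi> * v" by (rule dvdE)
      then show "(0, y) \<in> ?M0" using M0[of 0 v] by simp
    qed
  qed
  then have "?A \<noteq> {}" by blast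
  moreover have "\<Union>C \<in> ?A" if "C \<noteq> {}" and C: "subset.chain ?A C" for C
  proof -
    have pl: "partial_place \<pi> N" if "N \<in> C" for N using C that by (auto simp: subset_chain_def)
    have two: "\<exists>N\<in>C. z \<in> N \<and> z' \<in> N" if z: "z \<in> \<Union>C" "z' \<in> \<Union>C" for z z'
    proof -
      obtain N N' where "N \<in> C" "z \<in> N" "N' \<in> C" "z' \<in> N'" using z by blast
      moreover from this have "N \<subseteq> N' \<or> N' \<subseteq> N" using C by (simp add: subset_chain_def)
      ultimately show ?thesis by blast
    qed
    have "partial_place \<pi> (\<Union>C)"
    proof
      show "(1, 1) \<in> \<Union>C" using \<open>C \<noteq> {}\<close> partial_place.one[OF pl] by blast
      show "(a - b, y - z) \<in> \<Union>C" if ab: "(a, y) \<in> \<Union>C" "(b, z) \<in> \<Union>C" for a b y z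
      proof -
        obtain N where "N \<in> C" "(a, y) \<in> N" "(b, z) \<in> N" using two[OF ab] by blast
        then show ?thesis using partial_place.diff[OF pl] by blast
      qed
      show "(a * b, y * z) \<in> \<Union>C" if ab: "(a, y) \<in> \<Union>C" "(b, z) \<in> \<Union>C" for a b y z
      proof -
        obtain N where "N \<in> C" "(a, y) \<in> N" "(b, z) \<in> N" using two[OF ab] by blast
        then show ?thesis using partial_place.mult[OF pl] by blast
      qed
      show "(0, y) \<in> \<Union>C \<longleftrightarrow> \<pi> dvd y" for y
        using \<open>C \<noteq> {}\<close> partial_place.fibre[OF pl] by blast
    qed
    then show ?thesis by simp
  qed
  ultimately obtain M where M: "M \<in> ?A" "\<forall>N\<in>?A. M \<subseteq> N \<longrightarrow> N = M"
    using subset_Zorn_nonempty[of ?A] by blast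
  then have "maximal_place \<pi> M"
    by (auto simp: maximal_place_def maximal_place_axioms_def)
  then show thesis by (rule that)
qed

section \<open>Lifting representations along powers of a uniformizer\<close>

text \<open>In this part an \<open>n\<close> by \<open>n\<close> matrix is the function of its entries; entries outside the block are
  ignored. The laws of matrix algebra then hold without conditions on dimensions.\<close>

definition entry_mult :: "nat \<Rightarrow> (nat \<Rightarrow> nat \<Rightarrow> 'a) \<Rightarrow> (nat \<Rightarrow> nat \<Rightarrow> 'a) \<Rightarrow> nat \<Rightarrow> nat \<Rightarrow> 'a::comm_ring_1"
  where "entry_mult n P Q = (\<lambda>i j. \<Sum>k<n. P i k * Q k j)"

lemma entry_mult_assoc: "entry_mult n (entry_mult n P Q) Z = entry_mult n P (entry_mult n Q Z)"
proof (intro ext)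
  fix i j
  have "entry_mult n (entry_mult n P Q) Z i j = (\<Sum>k<n. \<Sum>l<n. P i l * (Q l k * Z k j))"
    by (simp add: entry_mult_def sum_distrib_right mult.assoc)
  also have "\<dots> = (\<Sum>l<n. \<Sum>k<n. P i l * (Q l k * Z k j))" by (rule sum.swap)
  finally show "entry_mult n (entry_mult n P Q) Z i j = entry_mult n P (entry_mult n Q Z) i j"
    by (simp add: entry_mult_def sum_distrib_left)
qed

lemma entry_mult_linear_left:
  "entry_mult n (\<lambda>i j. P i j - Q i j) Z i j = entry_mult n P Z i j - entry_mult n Q Z i j"
  "entry_mult n (\<lambda>i j. P i j + Q i j) Z i j = entry_mult n P Z i j + entry_mult n Q Z i j"
  "entry_mult n (\<lambda>i j. c * P i j) Z i j = c * entry_mult n P Z i j"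
  "entry_mult n (\<lambda>i j. \<Sum>l\<in>S. W l i j) Z i j = (\<Sum>l\<in>S. entry_mult n (W l) Z i j)"
  by (simp_all add: entry_mult_def algebra_simps sum_subtractf sum.distrib sum_distrib_left sum.swap[of _ S])

lemma entry_mult_linear_right:
  "entry_mult n Z (\<lambda>i j. P i j - Q i j) i j = entry_mult n Z P i j - entry_mult n Z Q i j"
  "entry_mult n Z (\<lambda>i j. c * P i j) i j = c * entry_mult n Z P i j"
  "entry_mult n Z (\<lambda>i j. \<Sum>l\<in>S. W l i j) i j = (\<Sum>l\<in>S. entry_mult n Z (W l) i j)"
  by (simp_all add: entry_mult_def algebra_simps sum_subtractf sum.distrib sum_distrib_left sum.swap[of _ S])

definition entry_cong :: "nat \<Rightarrow> 'a \<Rightarrow> (nat \<Rightarrow> nat \<Rightarrow> 'a) \<Rightarrow> (nat \<Rightarrow> nat \<Rightarrow> 'a::comm_ring_1) \<Rightarrow> bool"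
  where "entry_cong n q P Q \<longleftrightarrow> (\<forall>i<n. \<forall>j<n. q dvd P i j - Q i j)"

lemma entry_cong_refl: "entry_cong n q P P" by (simp add: entry_cong_def)

lemma entry_cong_sym: "entry_cong n q P Q \<Longrightarrow> entry_cong n q Q P"
  unfolding entry_cong_def by (metis dvd_minus_iff minus_diff_eq)

lemma entry_cong_trans [trans]: "entry_cong n q P Q \<Longrightarrow> entry_cong n q Q Z \<Longrightarrow> entry_cong n q P Z"
  unfolding entry_cong_def by (metis diff_add_cancel add_diff_eq dvd_add)

lemma entry_cong_dvd: "entry_cong n q P Q \<Longrightarrow> r dvd q \<Longrightarrow> entry_cong n r P Q"
  unfolding entry_cong_def using dvd_trans by blast

lemma entry_cong_mult:
  assumes "entry_cong n q P P'" "entry_cong n q Q Q'"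
  shows "entry_cong n q (entry_mult n P Q) (entry_mult n P' Q')"
  unfolding entry_cong_def
proof (intro allI impI)
  fix i j assume "i < n" "j < n"
  have "entry_mult n P Q i j - entry_mult n P' Q' i j = (\<Sum>k<n. (P i k - P' i k) * Q k j + (Q k j - Q' k j) * P' i k)"
    by (simp add: entry_mult_def algebra_simps sum_subtractf sum.distrib)
  then show "q dvd entry_mult n P Q i j - entry_mult n P' Q' i j"
    using assms \<open>i < n\<close> \<open>j < n\<close> by (auto simp: entry_cong_def intro!: dvd_sum dvd_add intro: dvd_mult2)
qed

lemma entry_cong_mult_square:
  assumes "\<And>i j. i < n \<Longrightarrow> j < n \<Longrightarrow> q dvd P i j" "entry_cong n q Q Q'" "i < n" "j < n"
  shows "q * q dvd entry_mult n P Q i j - entry_mult n P Q' i j"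
proof -
  have "entry_mult n P Q i j - entry_mult n P Q' i j = (\<Sum>k<n. P i k * (Q k j - Q' k j))"
    by (simp add: entry_mult_def algebra_simps sum_subtractf)
  then show ?thesis using assms by (auto simp: entry_cong_def intro!: dvd_sum mult_dvd_mono)
qed

definition entry_one :: "nat \<Rightarrow> nat \<Rightarrow> 'a::comm_ring_1" where "entry_one i j = (if i = j then 1 else 0)"

lemma entry_mult_one:
  "i < n \<Longrightarrow> entry_mult n entry_one P i j = P i j" "j < n \<Longrightarrow> entry_mult n P entry_one i j = P i j"
  by (simp_all add: entry_mult_def entry_one_def if_distrib[of "\<lambda>x. x * _"] if_distrib[of "\<lambda>x. _ * x"] cong: if_cong)

lemma correction_identity:
  fixes u :: "'v::comm_ring_1"
  shows "(u * m) * d - u * a - u * b + u * c + z = z - u * (a + b - c - m * d)"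
  by (simp add: distrib_left right_diff_distrib mult.assoc)

context group
begin

text \<open>For a map \<open>A\<close> from the group to matrices, \<open>defect\<close> is its failure to be multiplicative, a 2-cocycle
  for multiplication with \<open>A\<close> from both sides. If it vanishes modulo \<open>q\<close>, averaging over its last
  argument shows that it is modulo \<open>q * q\<close> the coboundary of \<open>defect_sum\<close> divided by the order of the
  group, so subtracting the latter (\<open>u\<close> is the inverse of the order) repairs the map modulo \<open>q * q\<close>.\<close>

definition defect :: "nat \<Rightarrow> ('a \<Rightarrow> nat \<Rightarrow> nat \<Rightarrow> 'v::comm_ring_1) \<Rightarrow> 'a \<Rightarrow> 'a \<Rightarrow> nat \<Rightarrow> nat \<Rightarrow> 'v"
  where "defect n A g h = (\<lambda>i j. entry_mult n (A g) (A h) i j - A (g \<otimes> h) i j)"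

definition defect_sum :: "nat \<Rightarrow> ('a \<Rightarrow> nat \<Rightarrow> nat \<Rightarrow> 'v::comm_ring_1) \<Rightarrow> 'a \<Rightarrow> nat \<Rightarrow> nat \<Rightarrow> 'v"
  where "defect_sum n A g = (\<lambda>i j. \<Sum>l\<in>carrier G. entry_mult n (defect n A g l) (A (inv l)) i j)"

definition corrected :: "nat \<Rightarrow> 'v \<Rightarrow> ('a \<Rightarrow> nat \<Rightarrow> nat \<Rightarrow> 'v::comm_ring_1) \<Rightarrow> 'a \<Rightarrow> nat \<Rightarrow> nat \<Rightarrow> 'v"
  where "corrected n u A g = (\<lambda>i j. A g i j - u * defect_sum n A g i j)"

text \<open>The identity is required to go exactly to the identity matrix; the correction keeps this, and it
  makes \<open>A (inv l)\<close> an inverse of \<open>A l\<close> modulo \<open>q\<close>. With \<open>q = 0\<close> this describes an honest homomorphism.\<close>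

definition hom_mod :: "nat \<Rightarrow> 'v \<Rightarrow> ('a \<Rightarrow> nat \<Rightarrow> nat \<Rightarrow> 'v::comm_ring_1) \<Rightarrow> bool"
  where "hom_mod n q A \<longleftrightarrow> entry_cong n 0 (A \<one>) entry_one \<and>
    (\<forall>g\<in>carrier G. \<forall>h\<in>carrier G. entry_cong n q (entry_mult n (A g) (A h)) (A (g \<otimes> h)))"

lemma defect_dvd:
  "hom_mod n q A \<Longrightarrow> g \<in> carrier G \<Longrightarrow> h \<in> carrier G \<Longrightarrow> i < n \<Longrightarrow> j < n \<Longrightarrow> q dvd defect n A g h i j"
  by (auto simp: hom_mod_def entry_cong_def defect_def)

lemma defect_sum_dvd:
  assumes "hom_mod n q A" "g \<in> carrier G" "i < n" "j < n"
  shows "q dvd defect_sum n A g i j"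
  unfolding defect_sum_def entry_mult_def using assms
  by (intro dvd_sum dvd_mult2) (auto intro: defect_dvd)

lemma defect_cocycle:
  assumes "g \<in> carrier G" "h \<in> carrier G" "l \<in> carrier G"
  shows "entry_mult n (A g) (defect n A h l) i j + defect n A g (h \<otimes> l) i j =
    entry_mult n (defect n A g h) (A l) i j + defect n A (g \<otimes> h) l i j"
  using assms by (simp add: defect_def entry_mult_linear_left entry_mult_linear_right entry_mult_assoc m_assoc)

text \<open>Multiply the cocycle identity on the right by \<open>A (inv l)\<close> and sum over \<open>l\<close>. The result is an exact
  identity between four terms, two of which are recognised modulo \<open>q * q\<close> because the defect
  contributes one factor \<open>q\<close> and the approximate multiplicativity of \<open>A\<close> the other.\<close>

lemma defect_sum_cocycle:
  assumes A: "hom_mod n q A"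
    and g: "g \<in> carrier G" and h: "h \<in> carrier G" and ij: "i < n" "j < n"
  shows "q * q dvd entry_mult n (A g) (defect_sum n A h) i j + entry_mult n (defect_sum n A g) (A h) i j
    - defect_sum n A (g \<otimes> h) i j - of_nat (card (carrier G)) * defect n A g h i j"
proof -
  \<comment> \<open>Approximately the order of the group times the identity matrix.\<close>
  define N where "N = (\<lambda>i j. \<Sum>l\<in>carrier G. entry_mult n (A l) (A (inv l)) i j)"
  \<comment> \<open>Approximately \<open>defect_sum n A g\<close> times \<open>A h\<close>, by the substitution \<open>l \<mapsto> inv h \<otimes> l\<close>.\<close>
  define R where "R = (\<lambda>i j. \<Sum>l\<in>carrier G. entry_mult n (defect n A g (h \<otimes> l)) (A (inv l)) i j)"
  have exact: "entry_mult n (A g) (defect_sum n A h) i j + R i j =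
      entry_mult n (defect n A g h) N i j + defect_sum n A (g \<otimes> h) i j"
  proof -
    have "entry_mult n (entry_mult n (A g) (defect n A h l)) (A (inv l)) i j + entry_mult n (defect n A g (h \<otimes> l)) (A (inv l)) i j
        = entry_mult n (entry_mult n (defect n A g h) (A l)) (A (inv l)) i j + entry_mult n (defect n A (g \<otimes> h) l) (A (inv l)) i j"
      if "l \<in> carrier G" for l
    proof -
      have "(\<lambda>i j. entry_mult n (A g) (defect n A h l) i j + defect n A g (h \<otimes> l) i j) =
          (\<lambda>i j. entry_mult n (defect n A g h) (A l) i j + defect n A (g \<otimes> h) l i j)"
        using defect_cocycle[OF g h that] by blast
      from arg_cong[OF this, of "\<lambda>P. entry_mult n P (A (inv l)) i j"] show ?thesis
        by (simp only: entry_mult_linear_left(2))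
    qed
    then show ?thesis
      by (simp add: defect_sum_def R_def N_def entry_mult_linear_right entry_mult_assoc flip: sum.distrib)
  qed
  have R: "q * q dvd R i j - entry_mult n (defect_sum n A g) (A h) i j"
  proof -
    have "R i j = (\<Sum>l\<in>carrier G. entry_mult n (defect n A g l) (A (inv l \<otimes> h)) i j)"
      unfolding R_def
      by (rule sum.reindex_bij_witness[of _ "\<lambda>l. inv h \<otimes> l" "\<lambda>l. h \<otimes> l"])
        (use h in \<open>auto simp: inv_mult_group m_assoc inv_solve_left m_assoc[symmetric]\<close>)
    moreover have "entry_mult n (defect_sum n A g) (A h) i j =
        (\<Sum>l\<in>carrier G. entry_mult n (defect n A g l) (entry_mult n (A (inv l)) (A h)) i j)"
      by (simp add: defect_sum_def entry_mult_linear_left entry_mult_assoc)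
    moreover have "q * q dvd entry_mult n (defect n A g l) (A (inv l \<otimes> h)) i j - entry_mult n (defect n A g l) (entry_mult n (A (inv l)) (A h)) i j"
      if "l \<in> carrier G" for l
      using A g h that ij
      by (intro entry_cong_mult_square) (auto intro: defect_dvd entry_cong_sym simp: hom_mod_def)
    ultimately show ?thesis by (auto simp flip: sum_subtractf intro: dvd_sum)
  qed
  have N: "q * q dvd entry_mult n (defect n A g h) N i j - of_nat (card (carrier G)) * defect n A g h i j"
  proof -
    have "entry_cong n q N (\<lambda>i j. of_nat (card (carrier G)) * entry_one i j)"
      unfolding entry_cong_def
    proof (intro allI impI)
      fix i j assume ij: "i < n" "j < n"
      have "N i j - of_nat (card (carrier G)) * entry_one i j =
          (\<Sum>l\<in>carrier G. entry_mult n (A l) (A (inv l)) i j - entry_one i j)"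
        by (simp add: N_def sum_subtractf)
      moreover have "q dvd entry_mult n (A l) (A (inv l)) i j - entry_one i j" if "l \<in> carrier G" for l
      proof -
        have "A \<one> i j = entry_one i j" using A ij by (simp add: hom_mod_def entry_cong_def)
        moreover have "entry_cong n q (entry_mult n (A l) (A (inv l))) (A \<one>)"
          using A that unfolding hom_mod_def by (metis inv_closed r_inv)
        ultimately show ?thesis using ij unfolding entry_cong_def by metis
      qed
      ultimately show "q dvd N i j - of_nat (card (carrier G)) * entry_one i j" by (auto intro: dvd_sum)
    qed
    from entry_cong_mult_square[OF defect_dvd[OF A g h] this ij] show ?thesis
      by (simp add: entry_mult_linear_right entry_mult_one ij)
  qed
  have "entry_mult n (A g) (defect_sum n A h) i j + entry_mult n (defect_sum n A g) (A h) i j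
      - defect_sum n A (g \<otimes> h) i j - of_nat (card (carrier G)) * defect n A g h i j =
      (entry_mult n (defect n A g h) N i j - of_nat (card (carrier G)) * defect n A g h i j) -
      (R i j - entry_mult n (defect_sum n A g) (A h) i j)"
    using exact by (simp add: algebra_simps)
  then show ?thesis using dvd_diff[OF N R] by (simp only:)
qed

text \<open>In the product of two corrected matrices the terms linear in \<open>defect_sum\<close> cancel the defect modulo
  \<open>q * q\<close>, and the quadratic term is divisible by \<open>q * q\<close>.\<close>

lemma corrected_hom_mod:
  assumes A: "hom_mod n q A" and u: "u * of_nat (card (carrier G)) = 1"
  shows "hom_mod n (q * q) (corrected n u A)"
  unfolding hom_mod_def
proof (intro conjI ballI)
  have 1: "A \<one> i j = entry_one i j" if "i < n" "j < n" for i j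
    using A that by (simp add: hom_mod_def entry_cong_def)
  have "entry_mult n (A \<one>) P i j = P i j" if "i < n" for P i j
  proof -
    have "entry_mult n (A \<one>) P i j = entry_mult n entry_one P i j"
      unfolding entry_mult_def using that 1 by (intro sum.cong) auto
    then show ?thesis using entry_mult_one(1)[OF that] by simp
  qed
  then have "defect_sum n A \<one> i j = 0" if "i < n" "j < n" for i j
    using that by (simp add: defect_sum_def defect_def entry_mult_def)
  then show "entry_cong n 0 (corrected n u A \<one>) entry_one"
    by (simp add: entry_cong_def corrected_def 1)
next
  fix g h assume g: "g \<in> carrier G" and h: "h \<in> carrier G"
  show "entry_cong n (q * q) (entry_mult n (corrected n u A g) (corrected n u A h)) (corrected n u A (g \<otimes> h))"
    unfolding entry_cong_def
  proof (intro allI impI)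
    fix i j assume ij: "i < n" "j < n"
    let ?D = "defect_sum n A"
    let ?C = "entry_mult n (A g) (?D h) i j + entry_mult n (?D g) (A h) i j - ?D (g \<otimes> h) i j - of_nat (card (carrier G)) * defect n A g h i j"
    have eq: "entry_mult n (corrected n u A g) (corrected n u A h) i j - corrected n u A (g \<otimes> h) i j =
        u * u * entry_mult n (?D g) (?D h) i j - u * ?C"
    proof -
      have "entry_mult n (corrected n u A g) (corrected n u A h) i j - corrected n u A (g \<otimes> h) i j =
          (u * of_nat (card (carrier G))) * defect n A g h i j
          - u * entry_mult n (A g) (?D h) i j - u * entry_mult n (?D g) (A h) i j + u * ?D (g \<otimes> h) i j
          + u * u * entry_mult n (?D g) (?D h) i j"
        unfolding u by (simp add: corrected_def defect_def entry_mult_linear_left entry_mult_linear_right right_diff_distrib)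
      then show ?thesis unfolding correction_identity .
    qed
    have "q * q dvd entry_mult n (?D g) (?D h) i j"
      unfolding entry_mult_def using defect_sum_dvd[OF A] g h ij by (intro dvd_sum mult_dvd_mono) auto
    then show "q * q dvd entry_mult n (corrected n u A g) (corrected n u A h) i j - corrected n u A (g \<otimes> h) i j"
      unfolding eq using defect_sum_cocycle[OF A g h ij] by (rule dvd_diff[OF dvd_mult dvd_mult])
  qed
qed

lemma corrected_entry_cong:
  assumes "hom_mod n q A" "g \<in> carrier G"
  shows "entry_cong n q (corrected n u A g) (A g)"
  using defect_sum_dvd[OF assms] by (simp add: entry_cong_def corrected_def)

text \<open>Iterating the correction gives maps that are multiplicative modulo growing powers of \<open>\<pi>\<close> and that
  form Cauchy sequences in each entry; the limit is multiplicative modulo all powers of \<open>\<pi>\<close>, hence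
  exactly.\<close>

lemma lift_hom:
  fixes \<pi> u :: "'v::comm_ring_1"
  assumes u: "u * of_nat (card (carrier G)) = 1"
    and complete: "\<And>w :: nat \<Rightarrow> 'v. \<forall>k. \<exists>N. \<forall>i\<ge>N. \<forall>j\<ge>N. \<pi> ^ k dvd w i - w j \<Longrightarrow>
      \<exists>l. \<forall>k. \<exists>N. \<forall>i\<ge>N. \<pi> ^ k dvd w i - l"
    and separated: "\<And>v. (\<And>k. \<pi> ^ k dvd v) \<Longrightarrow> v = 0"
    and A: "hom_mod n \<pi> A"
  obtains L where "hom_mod n 0 L" "\<And>g. g \<in> carrier G \<Longrightarrow> entry_cong n \<pi> (L g) (A g)"
proof -
  define S where "S k = (corrected n u ^^ k) A" for k
  have S: "hom_mod n (\<pi> ^ Suc k) (S k)" for k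
  proof (induction k)
    case (Suc k)
    have "hom_mod n (\<pi> ^ Suc k * \<pi> ^ Suc k) (S (Suc k))"
      using corrected_hom_mod[OF Suc u] by (simp add: S_def)
    moreover have "\<pi> ^ Suc (Suc k) dvd \<pi> ^ Suc k * \<pi> ^ Suc k"
      by (simp only: power_add[symmetric]) (intro le_imp_power_dvd, simp)
    ultimately show ?case unfolding hom_mod_def using entry_cong_dvd by blast
  qed (use A in \<open>simp add: S_def\<close>)
  have step: "entry_cong n (\<pi> ^ Suc k) (S (Suc k) g) (S k g)" if "g \<in> carrier G" for k g
    using corrected_entry_cong[OF S that] by (simp add: S_def)
  have later: "entry_cong n (\<pi> ^ Suc k) (S (k + m) g) (S k g)" if "g \<in> carrier G" for k m g
  proof (induction m)
    case (Suc m)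
    have "entry_cong n (\<pi> ^ Suc k) (S (k + Suc m) g) (S (k + m) g)"
      unfolding add_Suc_right by (rule entry_cong_dvd[OF step[OF that]]) (intro le_imp_power_dvd, simp)
    then show ?case using Suc entry_cong_trans by blast
  qed (simp add: entry_cong_refl)
  have "\<exists>l. \<forall>k. \<exists>N. \<forall>m\<ge>N. \<pi> ^ k dvd S m g i j - l"
    if "g \<in> carrier G" "i < n" "j < n" for g i j
  proof (rule complete, intro allI exI impI)
    fix k m m' :: nat assume "k \<le> m" "k \<le> m'"
    then have "entry_cong n (\<pi> ^ Suc k) (S m g) (S k g)" "entry_cong n (\<pi> ^ Suc k) (S m' g) (S k g)"
      using later[OF that(1), of k "m - k"] later[OF that(1), of k "m' - k"] by simp_all
    then have "entry_cong n (\<pi> ^ k) (S m g) (S k g)" "entry_cong n (\<pi> ^ k) (S m' g) (S k g)"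
      by (auto elim!: entry_cong_dvd)
    then have "entry_cong n (\<pi> ^ k) (S m g) (S m' g)" using entry_cong_sym entry_cong_trans by blast
    then show "\<pi> ^ k dvd S m g i j - S m' g i j" using that by (simp add: entry_cong_def)
  qed
  then obtain L where L: "\<And>g i j k. g \<in> carrier G \<Longrightarrow> i < n \<Longrightarrow> j < n \<Longrightarrow>
      \<exists>N. \<forall>m\<ge>N. \<pi> ^ k dvd S m g i j - L g i j"
    by metis
  have limit: "entry_cong n (\<pi> ^ Suc k) (L g) (S k g)" if g: "g \<in> carrier G" for k g
    unfolding entry_cong_def
  proof (intro allI impI)
    fix i j assume ij: "i < n" "j < n"
    obtain N where N: "\<forall>m\<ge>N. \<pi> ^ Suc k dvd S m g i j - L g i j" using L[OF g ij] by blast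
    have "\<pi> ^ Suc k dvd S (k + N) g i j - L g i j" using N by simp
    moreover have "\<pi> ^ Suc k dvd S (k + N) g i j - S k g i j"
      using later[OF g, of k N] ij unfolding entry_cong_def by blast
    ultimately have "\<pi> ^ Suc k dvd (S (k + N) g i j - S k g i j) - (S (k + N) g i j - L g i j)"
      by (rule dvd_diff[rotated])
    then show "\<pi> ^ Suc k dvd L g i j - S k g i j" by simp
  qed
  have exact: "entry_cong n 0 P Q" if "\<And>k::nat. entry_cong n (\<pi> ^ Suc k) P Q" for P Q
    unfolding entry_cong_def
  proof (intro allI impI)
    fix i j assume "i < n" "j < n"
    then have "\<pi> ^ Suc k dvd P i j - Q i j" for k :: nat using that[of k] unfolding entry_cong_def by blast
    then have "\<pi> ^ k dvd P i j - Q i j" for k :: nat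
      by (rule power_le_dvd[where n = "Suc k"]) simp
    then have "P i j - Q i j = 0" by (rule separated)
    then show "0 dvd P i j - Q i j" by simp
  qed
  have "hom_mod n 0 L"
    unfolding hom_mod_def
  proof (intro conjI ballI exact)
    fix k
    have "entry_cong n (\<pi> ^ Suc k) (S k \<one>) entry_one"
      using S[of k] entry_cong_dvd unfolding hom_mod_def by blast
    then show "entry_cong n (\<pi> ^ Suc k) (L \<one>) entry_one" using limit[of \<one> k] entry_cong_trans by blast
  next
    fix g h k assume gh: "g \<in> carrier G" "h \<in> carrier G"
    have "entry_cong n (\<pi> ^ Suc k) (entry_mult n (L g) (L h)) (entry_mult n (S k g) (S k h))"
      using gh by (intro entry_cong_mult limit)
    also have "entry_cong n (\<pi> ^ Suc k) (entry_mult n (S k g) (S k h)) (S k (g \<otimes> h))"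
      using S[of k] gh unfolding hom_mod_def by blast
    also have "entry_cong n (\<pi> ^ Suc k) (S k (g \<otimes> h)) (L (g \<otimes> h))"
      using gh by (intro entry_cong_sym[OF limit]) simp
    finally show "entry_cong n (\<pi> ^ Suc k) (entry_mult n (L g) (L h)) (L (g \<otimes> h))" .
  qed
  moreover have "entry_cong n \<pi> (L g) (A g)" if "g \<in> carrier G" for g
    using limit[OF that, of 0] by (simp add: S_def)
  ultimately show thesis by (rule that)
qed

end

section \<open>Finite linear groups over the valuation ring of a place\<close>

lemma matrix_inverse_if_det:
  fixes A :: "'a::field mat"
  assumes "A \<in> carrier_mat n n" "Determinant.det A \<noteq> 0"
  obtains B where "B \<in> carrier_mat n n" "A * B = 1\<^sub>m n" "B * A = 1\<^sub>m n"
proof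
  note adj = adj_mat[OF assms(1)]
  let ?B = "inverse (Determinant.det A) \<cdot>\<^sub>m adj_mat A"
  show "?B \<in> carrier_mat n n" using adj by simp
  show "A * ?B = 1\<^sub>m n"
    using assms adj by (subst mult_smult_distrib[of _ n n]) (auto intro!: eq_matI)
  show "?B * A = 1\<^sub>m n"
    using assms adj by (subst mult_smult_assoc_mat[of _ n n]) (auto intro!: eq_matI)
qed

context partial_place
begin

lemma det_mem:
  assumes "A \<in> carrier_mat n n" "B \<in> carrier_mat n n"
    and "\<And>i j. i < n \<Longrightarrow> j < n \<Longrightarrow> (A $$ (i, j), B $$ (i, j)) \<in> M"
  shows "(Determinant.det A, Determinant.det B) \<in> M"
proof -
  have sign: "(signof p, signof p) \<in> M" for p :: "nat \<Rightarrow> nat"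
    using one diff[OF zero one] by (auto simp: sign_def)
  show ?thesis unfolding det_def'[OF assms(1)] det_def'[OF assms(2)]
    by (intro sum mult sign prod assms(3)) (auto dest: permutes_in_image[of _ _ "_::nat"])
qed

lemma prime_power: "\<pi> dvd x ^ k \<Longrightarrow> \<pi> dvd x"
proof (rule ccontr)
  assume "\<pi> dvd x ^ k" "\<not> \<pi> dvd x"
  then have "x ^ k dvd 1" using unit[of x] dvd_power_same[of x 1 k] by simp
  then show False using \<open>\<pi> dvd x ^ k\<close> nonunit dvd_trans by blast
qed

text \<open>For a finite group \<open>S\<close> of matrices that all reduce to the identity, the sum \<open>T\<close> of its elements
  satisfies \<open>C g * T = T\<close>, while \<open>T\<close> reduces to \<open>card S\<close> times the identity. As the residue
  characteristic does not divide \<open>card S\<close>, the determinant of \<open>T\<close> is nonzero, and \<open>T\<close> can be cancelled.\<close>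

lemma reduction_faithful:
  fixes C :: "'c \<Rightarrow> 'k mat"
  assumes G: "group G" and S: "subgroup S G" and fin: "finite S"
    and nd: "\<not> \<pi> dvd of_nat (card S)"
    and C: "\<And>g. g \<in> S \<Longrightarrow> C g \<in> carrier_mat n n"
    and hom: "\<And>g h. g \<in> S \<Longrightarrow> h \<in> S \<Longrightarrow> C (g \<otimes>\<^bsub>G\<^esub> h) = C g * C h"
    and red: "\<And>g i j. g \<in> S \<Longrightarrow> i < n \<Longrightarrow> j < n \<Longrightarrow> (C g $$ (i, j), entry_one i j) \<in> M"
    and g: "g \<in> S"
  shows "C g = 1\<^sub>m n"
proof -
  interpret group G by fact
  interpret S: subgroup S G by fact
  define T where "T = mat n n (\<lambda>(i, j). \<Sum>l\<in>S. C l $$ (i, j))"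
  have T: "T \<in> carrier_mat n n" by (simp add: T_def)
  have absorb: "C g * T = T"
  proof (rule eq_matI)
    fix i j assume ij: "i < dim_row T" "j < dim_col T"
    then have ij': "i < n" "j < n" by (simp_all add: T_def)
    have "(C g * T) $$ (i, j) = (\<Sum>k=0..<n. C g $$ (i, k) * (\<Sum>l\<in>S. C l $$ (k, j)))"
      using ij' C[OF g] T by (simp add: scalar_prod_def) (simp add: T_def)
    also have "\<dots> = (\<Sum>l\<in>S. \<Sum>k=0..<n. C g $$ (i, k) * C l $$ (k, j))"
      by (simp only: sum_distrib_left sum.swap[of _ S])
    also have "\<dots> = (\<Sum>l\<in>S. C (g \<otimes>\<^bsub>G\<^esub> l) $$ (i, j))"
    proof (rule sum.cong)
      fix l assume l: "l \<in> S"
      show "(\<Sum>k=0..<n. C g $$ (i, k) * C l $$ (k, j)) = C (g \<otimes>\<^bsub>G\<^esub> l) $$ (i, j)"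
        using ij' C[OF g] C[OF l] by (simp add: hom[OF g l] scalar_prod_def)
    qed simp
    also have "\<dots> = (\<Sum>l\<in>S. C l $$ (i, j))"
      by (rule sum.reindex_bij_witness[of _ "\<lambda>l. inv\<^bsub>G\<^esub> g \<otimes>\<^bsub>G\<^esub> l" "\<lambda>l. g \<otimes>\<^bsub>G\<^esub> l"])
        (use g S.mem_carrier in \<open>auto simp: m_assoc[symmetric]\<close>)
    finally show "(C g * T) $$ (i, j) = T $$ (i, j)" using ij' by (simp add: T_def)
  qed (use C[OF g] T in auto)
  have "Determinant.det T \<noteq> 0"
  proof -
    have "(Determinant.det T, Determinant.det (of_nat (card S) \<cdot>\<^sub>m 1\<^sub>m n :: 'v mat)) \<in> M"
    proof (rule det_mem[OF T])
      fix i j assume ij: "i < n" "j < n"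
      have "((\<Sum>l\<in>S. C l $$ (i, j)), (\<Sum>l\<in>S. entry_one i j)) \<in> M"
        using red ij by (intro sum) auto
      then show "(T $$ (i, j), (of_nat (card S) \<cdot>\<^sub>m 1\<^sub>m n :: 'v mat) $$ (i, j)) \<in> M"
        using ij by (simp add: T_def entry_one_def)
    qed simp
    then have "(Determinant.det T, of_nat (card S) ^ n) \<in> M" by simp
    then show ?thesis using residue_nonzero prime_power nd by blast
  qed
  then obtain U where U: "U \<in> carrier_mat n n" "T * U = 1\<^sub>m n"
    using matrix_inverse_if_det[OF T] by blast
  have "C g = C g * (T * U)" using C[OF g] U(2) by simp
  also have "\<dots> = (C g * T) * U" using C[OF g] T U(1) by (simp add: assoc_mult_mat[of _ n n _ n _ n])
  also have "\<dots> = 1\<^sub>m n" unfolding absorb U(2) ..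
  finally show ?thesis .
qed

end

context maximal_place
begin

text \<open>In a valuation ring divisibility is total, so among finitely many elements of the field one
  divides all the others.\<close>

lemma exists_dominant:
  assumes "finite A" "a0 \<in> A" "d a0 \<noteq> 0"
  shows "\<exists>a\<in>A. d a \<noteq> 0 \<and> (\<forall>b\<in>A. \<exists>w. (d b / d a, w) \<in> M)"
proof -
  have refl: "\<exists>w. (d a / d a, w) \<in> M" if "d a \<noteq> 0" for a using that one by auto
  have trans: "\<exists>w. (d c / d a, w) \<in> M"
    if ex: "\<exists>w. (d b / d a, w) \<in> M" "\<exists>w. (d c / d b, w) \<in> M" and nz: "d b \<noteq> 0" for a b c
  proof -
    obtain v w where "(d b / d a, v) \<in> M" "(d c / d b, w) \<in> M" using ex by blast
    from mult[OF this] show ?thesis using nz by auto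
  qed
  have "\<exists>a\<in>insert a0 B. d a \<noteq> 0 \<and> (\<forall>b\<in>insert a0 B. \<exists>w. (d b / d a, w) \<in> M)" if "finite B" for B
    using that
  proof induction
    case empty
    then show ?case using assms(3) refl by auto
  next
    case (insert x B)
    then obtain a where a: "a \<in> insert a0 B" "d a \<noteq> 0" "\<forall>b\<in>insert a0 B. \<exists>w. (d b / d a, w) \<in> M"
      by blast
    show ?case
    proof (cases "\<exists>w. (d x / d a, w) \<in> M")
      case True
      then show ?thesis using a by (intro bexI[of _ a]) auto
    next
      case False
      then have "d x \<noteq> 0" using zero by auto
      then have "\<exists>w. (d a / d x, w) \<in> M"
        using False valuation_ring[of "d x / d a"] a(2) by auto
      then show ?thesis using a \<open>d x \<noteq> 0\<close> refl trans[of a x]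
        by (intro bexI[of _ x]) auto
    qed
  qed
  from this[OF assms(1)] show ?thesis using assms(2) by (simp add: insert_absorb)
qed

text \<open>This replaces the choice of a basis of an invariant lattice. The columns of \<open>P\<close> are chosen among the
  columns of elements of \<open>H\<close> so that \<open>det P\<close> divides all determinants formed from such columns. By
  Cramer's rule each of these columns is then a combination of the columns of \<open>P\<close> with coefficients
  in the domain of the place. Since \<open>H\<close> permutes this set of columns, its matrices in the basis
  \<open>P\<close> have entries in the domain.\<close>

lemma conjugate_into_valuation_ring:
  fixes H :: "'k mat set"
  assumes fin: "finite H" and H: "H \<subseteq> carrier_mat n n" and one: "1\<^sub>m n \<in> H"
    and closed: "\<And>g h. g \<in> H \<Longrightarrow> h \<in> H \<Longrightarrow> g * h \<in> H"
  obtains P Q where "P \<in> carrier_mat n n" "Q \<in> carrier_mat n n" "P * Q = 1\<^sub>m n" "Q * P = 1\<^sub>m n"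
    "\<And>h i j. h \<in> H \<Longrightarrow> i < n \<Longrightarrow> j < n \<Longrightarrow> \<exists>w. ((Q * h * P) $$ (i, j), w) \<in> M"
proof -
  define S where "S = (\<lambda>(h, j). col h j) ` (H \<times> {..<n})"
  define mk where "mk f = mat n n (\<lambda>(i, j). f j $ i)" for f :: "nat \<Rightarrow> 'k vec"
  define D where "D = mk ` ({..<n} \<rightarrow>\<^sub>E S)"
  have Smem: "col h j \<in> S" if "h \<in> H" "j < n" for h j
    using that by (auto simp: S_def)
  have Scarr: "v \<in> carrier_vec n" if "v \<in> S" for v
    using that H by (auto simp: S_def)
  have Dmem: "A \<in> D" if "A \<in> carrier_mat n n" "\<And>j. j < n \<Longrightarrow> col A j \<in> S" for A
  proof -
    have "A = mk (restrict (col A) {..<n})"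
      using that(1) by (intro eq_matI) (auto simp: mk_def)
    then show ?thesis unfolding D_def using that(2) by (intro image_eqI) auto
  qed
  have Dcol: "A \<in> carrier_mat n n" "j < n \<Longrightarrow> col A j \<in> S" if A: "A \<in> D" for A j
  proof -
    obtain f where f: "f \<in> {..<n} \<rightarrow>\<^sub>E S" "A = mk f" using A by (auto simp: D_def)
    then show "A \<in> carrier_mat n n" by (simp add: mk_def)
    assume j: "j < n"
    then have "f j \<in> S" using f by auto
    moreover have "col A j = f j"
      using Scarr[OF \<open>f j \<in> S\<close>] j f by (intro eq_vecI) (auto simp: mk_def)
    ultimately show "col A j \<in> S" by simp
  qed
  have "finite S" using fin by (simp add: S_def)
  then have "finite D" unfolding D_def by (intro finite_imageI finite_PiE) auto
  moreover have "1\<^sub>m n \<in> D" using Smem[OF one] by (intro Dmem) auto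
  ultimately obtain P where P: "P \<in> D" "Determinant.det P \<noteq> 0"
    and dom: "\<And>A. A \<in> D \<Longrightarrow> \<exists>w. (Determinant.det A / Determinant.det P, w) \<in> M"
    using exists_dominant[of D "1\<^sub>m n" Determinant.det] by auto
  note Pc = Dcol(1)[OF P(1)]
  obtain Q where Q: "Q \<in> carrier_mat n n" "P * Q = 1\<^sub>m n" "Q * P = 1\<^sub>m n"
    using matrix_inverse_if_det[OF Pc P(2)] by blast
  have "\<exists>w. ((Q * h * P) $$ (i, j), w) \<in> M" if h: "h \<in> H" and i: "i < n" and j: "j < n" for h i j
  proof -
    have hc: "h \<in> carrier_mat n n" using h H by auto
    define Y where "Y = Q * h * P"
    have Yc: "Y \<in> carrier_mat n n" using Q Pc hc by (simp add: Y_def)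
    have "P * Y = h * P"
    proof -
      have "P * Y = (P * Q) * (h * P)"
        unfolding Y_def using Q(1) Pc hc by (simp add: assoc_mult_mat[of _ n n _ n _ n])
      then show ?thesis using Q(2) Pc hc by simp
    qed
    then have "P *\<^sub>v col Y j = h *\<^sub>v col P j"
      using Pc Yc hc j by (metis col_mult2)
    moreover have "h *\<^sub>v col P j \<in> S"
    proof -
      obtain h' j' where h': "col P j = col h' j'" "h' \<in> H" "j' < n"
        using Dcol(2)[OF P(1) j] by (auto simp: S_def)
      then have "h *\<^sub>v col P j = col (h * h') j'"
        using hc H by (metis col_mult2 subsetD)
      then show ?thesis using Smem[OF closed[OF h h'(2)] h'(3)] by simp
    qed
    ultimately have s: "P *\<^sub>v col Y j \<in> S" by simp
    define R where "R = replace_col P (P *\<^sub>v col Y j) i"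
    have "R \<in> D"
    proof (rule Dmem)
      show "R \<in> carrier_mat n n" using Pc by (simp add: R_def replace_col_def)
      fix k assume k: "k < n"
      have "col R k = (if k = i then P *\<^sub>v col Y j else col P k)"
        using Pc k Scarr[OF s] by (intro eq_vecI) (auto simp: R_def replace_col_def)
      then show "col R k \<in> S" using s Dcol(2)[OF P(1) k] by simp
    qed
    moreover have "Determinant.det R = Y $$ (i, j) * Determinant.det P"
      unfolding R_def using cramer_lemma_mat[OF Pc _ i, of "col Y j"] Yc i j by simp
    ultimately show ?thesis using dom[of R] P(2) by (simp add: Y_def)
  qed
  with Pc Q show thesis by (intro that)
qed

end

section \<open>Transferring finite linear groups to a complete discrete valuation ring\<close>

lemma GL_simps:
  "x \<otimes>\<^bsub>GL n\<^esub> y = x * y" "\<one>\<^bsub>GL n\<^esub> = 1\<^sub>m n"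
  by (simp_all add: GL_def units_of_def ring_mat_def)

lemma GL_group: "group (GL n :: 'a::comm_ring_1 mat monoid)"
proof -
  interpret ring "ring_mat TYPE('a) n ()" by (rule ring_mat)
  show ?thesis unfolding GL_def by (rule units_group)
qed

lemma GL_carrier_mat: "A \<in> carrier (GL n) \<Longrightarrow> A \<in> carrier_mat n n"
  by (simp add: GL_def units_of_def Units_def ring_mat_def)

lemma GL_memI:
  assumes "A \<in> carrier_mat n n" "B \<in> carrier_mat n n" "A * B = 1\<^sub>m n" "B * A = 1\<^sub>m n"
  shows "A \<in> carrier (GL n)"
  using assms by (auto simp: GL_def units_of_def Units_def ring_mat_def)

lemma adically_complete_limit:
  fixes w :: "nat \<Rightarrow> 'a::comm_ring_1"
  assumes "adically_complete univ_ring \<pi>" and "\<forall>k. \<exists>N. \<forall>i\<ge>N. \<forall>j\<ge>N. \<pi> ^ k dvd w i - w j"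
  shows "\<exists>l. \<forall>k. \<exists>N. \<forall>i\<ge>N. \<pi> ^ k dvd w i - l"
  using assms(1)[unfolded adically_complete_def univ_ring_pow univ_ring_PIdl univ_ring_minus univ_ring_simps, rule_format, of w]
    assms(2) by simp

text \<open>The factor \<open>1 + d + \<dots> + d\<^sup>m\<^sup>-\<^sup>1\<close> of \<open>d\<^sup>m - 1\<close> reduces to \<open>m\<close>, so it is not zero.\<close>

lemma (in alg_closed_residue) root_of_unity_eq_1:
  assumes "d ^ m = 1" "\<pi> dvd d - 1" "\<not> \<pi> dvd of_nat m"
  shows "d = 1"
proof -
  have eq: "d ^ k - 1 = (d - 1) * (\<Sum>i<k. d ^ i)" for k
    by (rule power_diff_1_eq)
  have "\<pi> dvd (\<Sum>i<m. d ^ i - 1)"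
    using assms(2) by (intro dvd_sum) (simp add: eq)
  then have "\<pi> dvd (\<Sum>i<m. d ^ i) - of_nat m" by (simp add: sum_subtractf)
  then have "(\<Sum>i<m. d ^ i) \<noteq> 0" using assms(3) by auto
  then show ?thesis using eq[of m] assms(1) by simp
qed

theorem proposition3p6:
  fixes \<pi> :: "'v :: {idom, ring_char_0}" and p n :: nat and H :: "complex mat set"
  assumes "discrete_valuation_ring (ring_of_type_algebra :: 'v ring)"
    and "uniformizer ring_of_type_algebra \<pi>"
    and "adically_complete ring_of_type_algebra \<pi>"
    and "algebraically_closed (residue_field ring_of_type_algebra \<pi>)"
    and "has_characteristic (residue_field ring_of_type_algebra \<pi>) p"
    and "p > 0"
    and "n \<ge> 1"
    and "subgroup H (GL n)"
    and "finite H"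
    and "\<not> p dvd card H"
  shows "\<exists>G :: 'v mat set. subgroup G (GL n) \<and> finite G \<and>
           (GL n)\<lparr>carrier := G\<rparr> \<cong> (GL n)\<lparr>carrier := H\<rparr> \<and>
           (H \<subseteq> SL n \<longrightarrow> G \<subseteq> SL n)"
proof -
  interpret alg_closed_residue \<pi>
    by (rule alg_closed_residue_dvr) fact+
  have nd: "\<not> \<pi> dvd of_nat m" if "m dvd card H" for m
    using that assms(10) residue_characteristic[OF assms(5), of m] dvd_trans by blast
  obtain M :: "(complex \<times> 'v) set" where "maximal_place \<pi> M"
    using exists_maximal_place[where 'k = complex] by auto
  then interpret maximal_place \<pi> M .
  interpret CGL: group "GL n :: complex mat monoid" by (rule GL_group)
  interpret VGL: group "GL n :: 'v mat monoid" by (rule GL_group)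
  interpret H: subgroup H "GL n" by fact
  define \<Gamma> where "\<Gamma> = (GL n)\<lparr>carrier := H\<rparr>"
  interpret \<Gamma>: group \<Gamma> unfolding \<Gamma>_def by (rule H.subgroup_is_group) (rule GL_group)
  have \<Gamma>: "carrier \<Gamma> = H" "x \<otimes>\<^bsub>\<Gamma>\<^esub> y = x * y" "\<one>\<^bsub>\<Gamma>\<^esub> = 1\<^sub>m n" for x y
    by (simp_all add: \<Gamma>_def GL_simps)
  have Hc: "h \<in> carrier_mat n n" if "h \<in> H" for h
    using that H.subset GL_carrier_mat by blast
  have H1: "1\<^sub>m n \<in> H" using \<Gamma>.one_closed by (simp only: \<Gamma>)
  have Hm: "g * h \<in> H" if "g \<in> H" "h \<in> H" for g h
    using \<Gamma>.m_closed[of g h] that by (simp only: \<Gamma>)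
  obtain P Q where PQ: "P \<in> carrier_mat n n" "Q \<in> carrier_mat n n" "P * Q = 1\<^sub>m n" "Q * P = 1\<^sub>m n"
    and int: "\<And>h i j. h \<in> H \<Longrightarrow> i < n \<Longrightarrow> j < n \<Longrightarrow> \<exists>w. ((Q * h * P) $$ (i, j), w) \<in> M"
    using conjugate_into_valuation_ring[OF assms(9) _ H1 Hm] Hc by blast
  define C where "C h = Q * h * P" for h
  have Cc: "C h \<in> carrier_mat n n" if "h \<in> H" for h using PQ Hc[OF that] by (simp add: C_def)
  have C1: "C (1\<^sub>m n) = 1\<^sub>m n" using PQ by (simp add: C_def)
  note mat_simps = assoc_mult_mat[of _ n n _ n _ n] mult_carrier_mat[of _ n n _ n] left_mult_one_mat[of _ n n] right_mult_one_mat[of _ n n]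
  have Cm: "C (g * h) = C g * C h" if "g \<in> H" "h \<in> H" for g h
  proof -
    note [simp] = PQ(1,2) Hc[OF that(1)] Hc[OF that(2)]
    have "C g * C h = Q * g * ((P * Q) * (h * P))"
      by (simp add: C_def mat_simps)
    also have "\<dots> = C (g * h)"
      by (simp add: PQ(3) C_def mat_simps)
    finally show ?thesis ..
  qed
  have Cinj: "h = P * C h * Q" if "h \<in> H" for h
  proof -
    note [simp] = PQ(1,2) Hc[OF that]
    have "P * C h * Q = (P * Q) * (h * (P * Q))"
      by (simp add: C_def mat_simps)
    then show ?thesis by (simp add: PQ(3) mat_simps)
  qed
  \<comment> \<open>Representatives of the reductions, with the identity matrix sent to itself on the nose.\<close>
  define A where "A h i j = (if h = 1\<^sub>m n then entry_one i j else SOME w. (C h $$ (i, j), w) \<in> M)" for h i j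
  have A: "(C h $$ (i, j), A h i j) \<in> M" if "h \<in> H" "i < n" "j < n" for h i j
  proof (cases "h = 1\<^sub>m n")
    case True
    then show ?thesis using that C1 one zero by (simp add: A_def entry_one_def)
  next
    case False
    then show ?thesis using someI_ex[OF int[OF that]] by (simp add: A_def C_def)
  qed
  have prod_entry: "C (g * h) $$ (i, j) = (\<Sum>k<n. C g $$ (i, k) * C h $$ (k, j))"
    if "g \<in> H" "h \<in> H" "i < n" "j < n" for g h i j
    using that Cc[OF that(1)] Cc[OF that(2)]
    by (simp add: Cm scalar_prod_def lessThan_atLeast0)
  have "\<Gamma>.hom_mod n \<pi> A"
    unfolding \<Gamma>.hom_mod_def \<Gamma>
  proof (intro conjI ballI)
    show "entry_cong n 0 (A (1\<^sub>m n)) entry_one" by (simp add: entry_cong_def A_def)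
    fix g h assume gh: "g \<in> H" "h \<in> H"
    show "entry_cong n \<pi> (entry_mult n (A g) (A h)) (A (g * h))"
      unfolding entry_cong_def
    proof (intro allI impI)
      fix i j assume ij: "i < n" "j < n"
      have "(C (g * h) $$ (i, j), entry_mult n (A g) (A h) i j) \<in> M"
        unfolding prod_entry[OF gh ij] entry_mult_def using gh ij by (intro sum mult A) auto
      then show "\<pi> dvd entry_mult n (A g) (A h) i j - A (g * h) i j"
        using A[OF Hm[OF gh] ij] by (rule residue_unique)
    qed
  qed
  moreover obtain u where "u * of_nat (card (carrier \<Gamma>)) = (1 :: 'v)"
    using unit[OF nd[of "card H"]] by (auto simp: \<Gamma> dvd_def mult.commute)
  ultimately obtain L where "\<Gamma>.hom_mod n 0 L" and LA: "\<And>h. h \<in> H \<Longrightarrow> entry_cong n \<pi> (L h) (A h)"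
    using \<Gamma>.lift_hom[OF _ adically_complete_limit[OF assms(3)] dvr_power_dvd_all[OF assms(1,2)], of u n A]
    unfolding \<Gamma> by blast
  then have L1: "L (1\<^sub>m n) i j = entry_one i j"
    and Lm: "g \<in> H \<Longrightarrow> h \<in> H \<Longrightarrow> entry_mult n (L g) (L h) i j = L (g * h) i j" if "i < n" "j < n" for g h i j
    using that by (simp_all add: \<Gamma>.hom_mod_def \<Gamma> entry_cong_def)
  \<comment> \<open>The lift still represents the reduction of \<open>C\<close>; faithfulness and determinants are read off from this.\<close>
  have CL: "(C h $$ (i, j), L h i j) \<in> M" if "h \<in> H" "i < n" "j < n" for h i j
  proof (rule residue_change[OF A[OF that]])
    show "\<pi> dvd A h i j - L h i j"
      using entry_cong_sym[OF LA[OF that(1)]] that(2,3) unfolding entry_cong_def by blast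
  qed
  define \<rho> where "\<rho> h = mat n n (\<lambda>(i, j). L h i j)" for h
  have \<rho>c: "\<rho> h \<in> carrier_mat n n" for h by (simp add: \<rho>_def)
  have \<rho>1: "\<rho> (1\<^sub>m n) = 1\<^sub>m n"
    by (rule eq_matI) (simp_all add: \<rho>_def L1 entry_one_def)
  have \<rho>m: "\<rho> (g * h) = \<rho> g * \<rho> h" if "g \<in> H" "h \<in> H" for g h
    by (rule eq_matI) (simp_all add: \<rho>_def Lm[symmetric] that scalar_prod_def entry_mult_def lessThan_atLeast0)
  have \<rho>GL: "\<rho> h \<in> carrier (GL n)" if h: "h \<in> H" for h
  proof -
    have inv: "inv\<^bsub>\<Gamma>\<^esub> h \<in> H" "h * inv\<^bsub>\<Gamma>\<^esub> h = 1\<^sub>m n" "inv\<^bsub>\<Gamma>\<^esub> h * h = 1\<^sub>m n"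
      using \<Gamma>.inv_closed[of h] \<Gamma>.r_inv[of h] \<Gamma>.l_inv[of h] h unfolding \<Gamma> by auto
    show ?thesis
      using \<rho>m[OF h inv(1)] \<rho>m[OF inv(1) h] inv \<rho>1 by (intro GL_memI[OF \<rho>c \<rho>c]) auto
  qed
  interpret \<rho>: group_hom \<Gamma> "GL n" \<rho>
    by unfold_locales (auto simp: hom_def \<Gamma> GL_simps \<rho>GL \<rho>m)
  \<comment> \<open>The kernel of the lift reduces trivially, so it is trivial on the complex side.\<close>
  define N where "N = kernel \<Gamma> (GL n) \<rho>"
  have N: "N = {h \<in> H. \<rho> h = 1\<^sub>m n}" by (auto simp: N_def kernel_def \<Gamma> GL_simps)
  have Nsub: "subgroup N \<Gamma>" unfolding N_def by (rule \<rho>.subgroup_kernel)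
  have "C h = 1\<^sub>m n" if h: "h \<in> N" for h
  proof (rule reduction_faithful[OF \<Gamma>.is_group Nsub _ _ _ _ _ h])
    show "finite N" using assms(9) by (simp add: N)
    have "card N dvd card H"
      using \<Gamma>.lagrange[OF Nsub] by (metis \<Gamma>(1) dvd_triv_right Coset.order_def)
    then show "\<not> \<pi> dvd of_nat (card N)" by (rule nd)
    fix g i j assume g: "g \<in> N" and ij: "i < n" "j < n"
    have "L g i j = \<rho> g $$ (i, j)" using ij by (simp add: \<rho>_def)
    also have "\<dots> = entry_one i j" using g ij by (simp add: N entry_one_def)
    finally show "(C g $$ (i, j), entry_one i j) \<in> M" using CL[of g i j] g ij by (simp add: N)
  qed (auto simp: N Cc Cm \<Gamma>)
  then have "h = 1\<^sub>m n" if "h \<in> N" for h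
    using Cinj[of h] that PQ by (simp add: N)
  then have "N \<subseteq> {1\<^sub>m n}" by blast
  moreover have "1\<^sub>m n \<in> N" using H1 \<rho>1 by (simp add: N)
  ultimately have "kernel \<Gamma> (GL n) \<rho> = {\<one>\<^bsub>\<Gamma>\<^esub>}" unfolding N_def \<Gamma> by blast
  from \<rho>.trivial_ker_imp_inj[OF this] have inj: "inj_on \<rho> H" by (simp only: \<Gamma>)
  have "subgroup (\<rho> ` H) (GL n)" using \<rho>.img_is_subgroup by (simp only: \<Gamma>)
  moreover have "finite (\<rho> ` H)" using assms(9) by simp
  moreover have "(GL n)\<lparr>carrier := \<rho> ` H\<rparr> \<cong> (GL n)\<lparr>carrier := H\<rparr>"
  proof -
    have "\<rho> \<in> iso \<Gamma> ((GL n)\<lparr>carrier := \<rho> ` H\<rparr>)"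
      using inj by (auto simp: iso_def hom_def bij_betw_def \<Gamma> GL_simps \<rho>m)
    then show ?thesis using \<Gamma>.iso_sym unfolding is_iso_def \<Gamma>_def by blast
  qed
  moreover have "\<rho> ` H \<subseteq> SL n" if SL: "H \<subseteq> SL n"
  proof
    fix B assume "B \<in> \<rho> ` H"
    then obtain h where h: "h \<in> H" "B = \<rho> h" by blast
    \<comment> \<open>The determinant of a lifted matrix is a root of unity of order prime to the residue
      characteristic and reduces to \<open>1\<close>.\<close>
    have "Determinant.det (C h) = Determinant.det Q * Determinant.det P"
      using PQ Hc[OF h(1)] SL h(1) by (auto simp: C_def SL_def det_mult[of _ n])
    also have "\<dots> = 1" using det_mult[OF PQ(2,1)] PQ(4) by simp
    finally have "(1, Determinant.det (\<rho> h)) \<in> M"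
      using det_mem[OF Cc[OF h(1)] \<rho>c, of h] CL[OF h(1)] by (simp add: \<rho>_def)
    then have red: "\<pi> dvd Determinant.det (\<rho> h) - 1" using one by (rule residue_unique)
    have "Determinant.det (\<rho> (h [^]\<^bsub>\<Gamma>\<^esub> k)) = Determinant.det (\<rho> h) ^ k" for k :: nat
    proof (induction k)
      case (Suc k)
      have "h [^]\<^bsub>\<Gamma>\<^esub> k \<in> H" using \<Gamma>.nat_pow_closed[of h k] h by (simp add: \<Gamma>)
      then show ?case using Suc h(1) by (simp add: \<Gamma> \<rho>m det_mult[OF \<rho>c \<rho>c])
    qed (simp add: \<Gamma> \<rho>1)
    moreover have "h [^]\<^bsub>\<Gamma>\<^esub> card H = 1\<^sub>m n"
      using \<Gamma>.pow_order_eq_1[of h] h by (simp add: \<Gamma> Coset.order_def)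
    ultimately have "Determinant.det (\<rho> h) ^ card H = 1" by (metis \<rho>1 det_one)
    then have "Determinant.det (\<rho> h) = 1"
      using red nd[OF dvd_refl] by (rule root_of_unity_eq_1)
    then show "B \<in> SL n" using h(2) \<rho>c by (simp add: SL_def)
  qed
  ultimately show ?thesis by blast
qed

end
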